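(* Let $H$ be an infinite-dimensional complex Hilbert space and let $\mathcal{F}_0=\mathcal{F}_0(H)$ be the space of bounded Fredholm operators on $H$ of index zero, with the operator norm topology. Then the Quillen determinant line bundle $\mathcal{L}_Q$ is not trivial (as a complex line bundle) on the whole space $\mathcal{F}_0$.
   Context: $\mathcal{I}_1$ denotes the space of trace class operators on $H$. For $K\in\mathcal{I}_1$, ${\det}_F(Id+K)=\prod(1+\lambda_i)$ is the Fredholm determinant, where $\lambda_i$ are the eigenvalues of $K$ (with algebraic multiplicity). For $A\in\mathcal{I}_1$ let $\mathcal{U}_A=\{T\in\mathcal{F}_0\mid T+A\text{ is invertible}\}$; these open sets cover $\mathcal{F}_0$. For $T\in\mathcal{F}_0$ let $\mathcal{A}_T=\{A\in\mathcal{I}_1\mid T+A\text{ is invertible}\}$ and let $\mathcal{D}_T$ be the one-dimensional complex vector space of functions $f:\mathcal{A}_T\to\mathbb{C}$ with $f(B)={\det}_F\{(T+A)(T+B)^{-1}\}f(A)$ for all $A,B\in\mathcal{A}_T$. Let $\pi_T$ be the orthogonal projection of $H$ onto $\operatorname{Ker}(T)$ and $\rho_T:H\to\operatorname{Coker}(T)$ the natural projection. Define an isomorphism $$\phi_T:\mathcal{D}_T\to \bigwedge^{\dim\operatorname{Ker}(T)}\operatorname{Ker}(T)^*\otimes\bigwedge^{\dim\operatorname{Coker}(T)}\operatorname{Coker}(T)$$ by $$\phi_T(f)=f(A)\,{\det}_F\{(T+A)(T+L\circ\pi_T)^{-1}\}\,e_1^*\wedge\cdots\wedge e_d^*\otimes\rho_T(L(e_1))\wedge\cdots\wedge\rho_T(L(e_d)),$$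 where $A\in\mathcal{A}_T$, $\{e_i\}_{i=1}^d$ is a basis of $\operatorname{Ker}(T)$ with dual basis $\{e_i^*\}$, and $L:\operatorname{Ker}(T)\to H$ is any linear map such that $\rho_T\circ L$ is an isomorphism onto $\operatorname{Coker}(T)$; the map is independent of these choices. The Quillen determinant line bundle $\mathcal{L}_Q$ is the complex line bundle over $\mathcal{F}_0$ with total space $$\coprod_{T\in\mathcal{F}_0}\bigwedge^{\dim\operatorname{Ker}(T)}\operatorname{Ker}(T)^*\otimes\bigwedge^{\dim\operatorname{Coker}(T)}\operatorname{Coker}(T),$$ whose topology and bundle structure are given by the local trivializations over $\mathcal{U}_A$ ($A\in\mathcal{I}_1$) sending $(T,z)\in\mathcal{U}_A\times\mathbb{C}$ to $\phi_T(f)$, where $f\in\mathcal{D}_T$ is the unique element with $f(A)=z$. *)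

theory Defs
  imports "HOL-Analysis.Analysis"
begin

section \<open>Complex Hilbert spaces\<close>

text \<open>The inner product is conjugate-linear in the first argument.\<close>

class chilbert = banach +
  fixes scaleC :: "complex \<Rightarrow> 'a \<Rightarrow> 'a"  (infixr "*\<^sub>C" 75)
    and cinner :: "'a \<Rightarrow> 'a \<Rightarrow> complex"
  assumes scaleC_add_right: "c *\<^sub>C (x + y) = c *\<^sub>C x + c *\<^sub>C y"
    and scaleC_add_left: "(c + d) *\<^sub>C x = c *\<^sub>C x + d *\<^sub>C x"
    and scaleC_scaleC: "c *\<^sub>C (d *\<^sub>C x) = (c * d) *\<^sub>C x"
    and scaleR_scaleC: "r *\<^sub>R x = complex_of_real r *\<^sub>C x"
    and cinner_commute: "cinner x y = cnj (cinner y x)"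
    and cinner_add_right: "cinner x (y + z) = cinner x y + cinner x z"
    and cinner_scaleC_right: "cinner x (c *\<^sub>C y) = c * cinner x y"
    and cinner_self: "cinner x x = complex_of_real ((norm x)\<^sup>2)"


section \<open>Complex vector spaces with explicit carrier\<close>

text \<open>Kernels, cokernels, exterior powers and tensor products depend on the operator, so
  they cannot be types; they are carried by records. The zero vector is \<open>0 \<cdot> v\<close>.\<close>

record 'a cvs =
  vcarrier :: "'a set"
  vadd :: "'a \<Rightarrow> 'a \<Rightarrow> 'a"
  vscale :: "complex \<Rightarrow> 'a \<Rightarrow> 'a"

definition hspace :: "'h::chilbert cvs" where
  "hspace = \<lparr>vcarrier = UNIV, vadd = (+), vscale = (*\<^sub>C)\<rparr>"

definition cline :: "complex cvs" where
  "cline = \<lparr>vcarrier = UNIV, vadd = (+), vscale = (*)\<rparr>"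

definition vsubspace :: "'a cvs \<Rightarrow> 'a set \<Rightarrow> bool" where
  "vsubspace V W \<longleftrightarrow> W \<subseteq> vcarrier V \<and> W \<noteq> {} \<and>
     (\<forall>x\<in>W. \<forall>y\<in>W. vadd V x y \<in> W) \<and> (\<forall>c. \<forall>x\<in>W. vscale V c x \<in> W)"

definition vspan :: "'a cvs \<Rightarrow> 'a set \<Rightarrow> 'a set" where
  "vspan V S = vsubspace V hull S"

definition vbasis :: "'a cvs \<Rightarrow> 'a set \<Rightarrow> bool" where
  "vbasis V B \<longleftrightarrow> B \<subseteq> vcarrier V \<and> vspan V B = vcarrier V \<and> (\<forall>b\<in>B. b \<notin> vspan V (B - {b}))"

definition vfinite_dim :: "'a cvs \<Rightarrow> bool" where
  "vfinite_dim V \<longleftrightarrow> (\<exists>B. finite B \<and> vbasis V B)"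

definition vdim :: "'a cvs \<Rightarrow> nat" where
  "vdim V = card (SOME B. vbasis V B)"

definition vlinear :: "'a cvs \<Rightarrow> 'b cvs \<Rightarrow> ('a \<Rightarrow> 'b) \<Rightarrow> bool" where
  "vlinear V W f \<longleftrightarrow> (\<forall>x\<in>vcarrier V. f x \<in> vcarrier W) \<and>
     (\<forall>x\<in>vcarrier V. \<forall>y\<in>vcarrier V. f (vadd V x y) = vadd W (f x) (f y)) \<and>
     (\<forall>c. \<forall>x\<in>vcarrier V. f (vscale V c x) = vscale W c (f x))"

definition vdual :: "'a cvs \<Rightarrow> ('a \<Rightarrow> complex) cvs" where
  "vdual V = \<lparr>vcarrier = {f \<in> extensional (vcarrier V). vlinear V cline f},
     vadd = (\<lambda>f g. restrict (\<lambda>x. f x + g x) (vcarrier V)),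
     vscale = (\<lambda>c f. restrict (\<lambda>x. c * f x) (vcarrier V))\<rparr>"

definition vcoset :: "'a cvs \<Rightarrow> 'a set \<Rightarrow> 'a \<Rightarrow> 'a set" where
  "vcoset V N x = {vadd V x n |n. n \<in> N}"

text \<open>Adding \<open>n\<close> in the scalar multiplication matters only for \<open>c = 0\<close>, where
  it yields the coset \<open>N\<close> instead of \<open>{0}\<close>.\<close>

definition vquot :: "'a cvs \<Rightarrow> 'a set \<Rightarrow> 'a set cvs" where
  "vquot V N = \<lparr>vcarrier = vcoset V N ` vcarrier V,
     vadd = (\<lambda>X Y. {vadd V x y |x y. x \<in> X \<and> y \<in> Y}),
     vscale = (\<lambda>c X. {vadd V (vscale V c x) n |x n. x \<in> X \<and> n \<in> N})\<rparr>"

definition vfree :: "'x set \<Rightarrow> ('x \<Rightarrow> complex) cvs" where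
  "vfree S = \<lparr>vcarrier = {f. finite {x. f x \<noteq> 0} \<and> {x. f x \<noteq> 0} \<subseteq> S},
     vadd = (\<lambda>f g x. f x + g x),
     vscale = (\<lambda>c f x. c * f x)\<rparr>"

definition delta :: "'x \<Rightarrow> 'x \<Rightarrow> complex" where
  "delta x = (\<lambda>y. if y = x then 1 else 0)"


subsection \<open>Exterior powers\<close>

definition tuples :: "nat \<Rightarrow> 'a cvs \<Rightarrow> 'a list set" where
  "tuples k V = {xs. length xs = k \<and> set xs \<subseteq> vcarrier V}"

definition ext_rels :: "nat \<Rightarrow> 'a cvs \<Rightarrow> ('a list \<Rightarrow> complex) set" where
  "ext_rels k V =
     {(\<lambda>t. delta (xs[i := vadd V u v]) t - delta (xs[i := u]) t - delta (xs[i := v]) t) |xs i u v.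
        xs \<in> tuples k V \<and> i < k \<and> u \<in> vcarrier V \<and> v \<in> vcarrier V} \<union>
     {(\<lambda>t. delta (xs[i := vscale V c u]) t - c * delta (xs[i := u]) t) |xs i c u.
        xs \<in> tuples k V \<and> i < k \<and> u \<in> vcarrier V} \<union>
     {delta xs |xs. xs \<in> tuples k V \<and> (\<exists>i j. i < j \<and> j < k \<and> xs ! i = xs ! j)}"

abbreviation ext_null :: "nat \<Rightarrow> 'a cvs \<Rightarrow> ('a list \<Rightarrow> complex) set" where
  "ext_null k V \<equiv> vspan (vfree (tuples k V)) (ext_rels k V)"

definition ext_power :: "nat \<Rightarrow> 'a cvs \<Rightarrow> ('a list \<Rightarrow> complex) set cvs" where
  "ext_power k V = vquot (vfree (tuples k V)) (ext_null k V)"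

definition wedge :: "'a cvs \<Rightarrow> 'a list \<Rightarrow> ('a list \<Rightarrow> complex) set" where
  "wedge V xs = vcoset (vfree (tuples (length xs) V)) (ext_null (length xs) V) (delta xs)"


subsection \<open>Tensor products\<close>

definition tensor_rels :: "'a cvs \<Rightarrow> 'b cvs \<Rightarrow> ('a \<times> 'b \<Rightarrow> complex) set" where
  "tensor_rels V W =
     {(\<lambda>t. delta (vadd V x x', y) t - delta (x, y) t - delta (x', y) t) |x x' y.
        x \<in> vcarrier V \<and> x' \<in> vcarrier V \<and> y \<in> vcarrier W} \<union>
     {(\<lambda>t. delta (x, vadd W y y') t - delta (x, y) t - delta (x, y') t) |x y y'.
        x \<in> vcarrier V \<and> y \<in> vcarrier W \<and> y' \<in> vcarrier W} \<union>
     {(\<lambda>t. delta (vscale V c x, y) t - c * delta (x, y) t) |c x y.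
        x \<in> vcarrier V \<and> y \<in> vcarrier W} \<union>
     {(\<lambda>t. delta (x, vscale W c y) t - c * delta (x, y) t) |c x y.
        x \<in> vcarrier V \<and> y \<in> vcarrier W}"

abbreviation tensor_null :: "'a cvs \<Rightarrow> 'b cvs \<Rightarrow> ('a \<times> 'b \<Rightarrow> complex) set" where
  "tensor_null V W \<equiv> vspan (vfree (vcarrier V \<times> vcarrier W)) (tensor_rels V W)"

definition tensor :: "'a cvs \<Rightarrow> 'b cvs \<Rightarrow> ('a \<times> 'b \<Rightarrow> complex) set cvs" where
  "tensor V W = vquot (vfree (vcarrier V \<times> vcarrier W)) (tensor_null V W)"

definition ptensor :: "'a cvs \<Rightarrow> 'b cvs \<Rightarrow> 'a \<Rightarrow> 'b \<Rightarrow> ('a \<times> 'b \<Rightarrow> complex) set" where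
  "ptensor V W x y = vcoset (vfree (vcarrier V \<times> vcarrier W)) (tensor_null V W) (delta (x, y))"


section \<open>Operators\<close>

text \<open>The type \<open>'h \<Rightarrow>\<^sub>L 'h\<close> consists of the bounded real-linear maps with the operator norm.\<close>

definition cbounded :: "('h::chilbert \<Rightarrow>\<^sub>L 'h) set" where
  "cbounded = {T. \<forall>c x. blinfun_apply T (c *\<^sub>C x) = c *\<^sub>C blinfun_apply T x}"

definition op_invertible :: "('h::chilbert \<Rightarrow>\<^sub>L 'h) \<Rightarrow> bool" where
  "op_invertible T \<longleftrightarrow> (\<exists>S\<in>cbounded. S o\<^sub>L T = id_blinfun \<and> T o\<^sub>L S = id_blinfun)"

definition Ker :: "('h::chilbert \<Rightarrow>\<^sub>L 'h) \<Rightarrow> 'h cvs" where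
  "Ker T = hspace\<lparr>vcarrier := {x. blinfun_apply T x = 0}\<rparr>"

definition Coker :: "('h::chilbert \<Rightarrow>\<^sub>L 'h) \<Rightarrow> 'h set cvs" where
  "Coker T = vquot hspace (range (blinfun_apply T))"

definition coker_proj :: "('h::chilbert \<Rightarrow>\<^sub>L 'h) \<Rightarrow> 'h \<Rightarrow> 'h set" where
  "coker_proj T = vcoset hspace (range (blinfun_apply T))"

definition orth_proj :: "'h::chilbert set \<Rightarrow> 'h \<Rightarrow> 'h" where
  "orth_proj S x = (THE y. y \<in> S \<and> (\<forall>z\<in>S. cinner z (x - y) = 0))"

text \<open>Closedness of the range need not be required: it follows from finite codimension.\<close>

definition fredholm :: "('h::chilbert \<Rightarrow>\<^sub>L 'h) \<Rightarrow> bool" where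
  "fredholm T \<longleftrightarrow> T \<in> cbounded \<and> vfinite_dim (Ker T) \<and> vfinite_dim (Coker T)"

definition fredholm_index :: "('h::chilbert \<Rightarrow>\<^sub>L 'h) \<Rightarrow> int" where
  "fredholm_index T = int (vdim (Ker T)) - int (vdim (Coker T))"

definition Fredholm0 :: "('h::chilbert \<Rightarrow>\<^sub>L 'h) set" where
  "Fredholm0 = {T. fredholm T \<and> fredholm_index T = 0}"


subsection \<open>Trace class operators\<close>

definition positive_op :: "('h::chilbert \<Rightarrow>\<^sub>L 'h) \<Rightarrow> bool" where
  "positive_op P \<longleftrightarrow> P \<in> cbounded \<and>
     (\<forall>x. Im (cinner x (blinfun_apply P x)) = 0 \<and> 0 \<le> Re (cinner x (blinfun_apply P x)))"

text \<open>\<open>P = |K|\<close>, that is \<open>P \<ge> 0\<close> and \<open>P\<^sup>2 = K\<^sup>* K\<close>; the adjoint is moved to the other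
  side of the inner product.\<close>

definition is_abs_op :: "('h::chilbert \<Rightarrow>\<^sub>L 'h) \<Rightarrow> ('h \<Rightarrow>\<^sub>L 'h) \<Rightarrow> bool" where
  "is_abs_op P K \<longleftrightarrow> positive_op P \<and>
     (\<forall>x y. cinner x (blinfun_apply P (blinfun_apply P y))
          = cinner (blinfun_apply K x) (blinfun_apply K y))"

definition orthonormal_basis :: "'h::chilbert set \<Rightarrow> bool" where
  "orthonormal_basis E \<longleftrightarrow> (\<forall>x\<in>E. \<forall>y\<in>E. cinner x y = (if x = y then 1 else 0)) \<and>
     closure (vspan hspace E) = UNIV"

definition trace_class :: "('h::chilbert \<Rightarrow>\<^sub>L 'h) set" where
  "trace_class = {K \<in> cbounded. \<exists>P E. is_abs_op P K \<and> orthonormal_basis E \<and>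
     (\<lambda>e. Re (cinner e (blinfun_apply P e))) summable_on E}"


subsection \<open>The Fredholm determinant\<close>

definition eigenvalues :: "('h::chilbert \<Rightarrow> 'h) \<Rightarrow> complex set" where
  "eigenvalues K = {l. \<exists>x. x \<noteq> 0 \<and> K x = l *\<^sub>C x}"

definition alg_mult :: "('h::chilbert \<Rightarrow> 'h) \<Rightarrow> complex \<Rightarrow> nat" where
  "alg_mult K l =
     vdim (hspace\<lparr>vcarrier := {x. \<exists>n. ((\<lambda>y. K y - l *\<^sub>C y) ^^ n) x = 0}\<rparr>)"

text \<open>The argument \<open>S\<close> is \<open>Id + K\<close>. The product over the eigenvalues of \<open>K\<close> is unordered,
  taken as the limit over finite subsets; the eigenvalue \<open>0\<close>, which contributes the factor \<open>1\<close>
  and may have infinite multiplicity, is left out.\<close>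

definition det_F :: "('h::chilbert \<Rightarrow> 'h) \<Rightarrow> complex" where
  "det_F S = (let K = (\<lambda>x. S x - x) in
     Lim (finite_subsets_at_top (eigenvalues K - {0}))
       (\<lambda>F. \<Prod>l\<in>F. (1 + l) ^ alg_mult K l))"


section \<open>The Quillen determinant line bundle\<close>

definition quillen_U :: "('h::chilbert \<Rightarrow>\<^sub>L 'h) \<Rightarrow> ('h \<Rightarrow>\<^sub>L 'h) set" where
  "quillen_U A = {T \<in> Fredholm0. op_invertible (T + A)}"

definition quillen_A :: "('h::chilbert \<Rightarrow>\<^sub>L 'h) \<Rightarrow> ('h \<Rightarrow>\<^sub>L 'h) set" where
  "quillen_A T = {A \<in> trace_class. op_invertible (T + A)}"

definition quillen_D :: "('h::chilbert \<Rightarrow>\<^sub>L 'h) \<Rightarrow> (('h \<Rightarrow>\<^sub>L 'h) \<Rightarrow> complex) set" where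
  "quillen_D T = {f \<in> extensional (quillen_A T). \<forall>A\<in>quillen_A T. \<forall>B\<in>quillen_A T.
     f B = det_F (blinfun_apply (T + A) \<circ> inv (blinfun_apply (T + B))) * f A}"

type_synonym 'h quillen_vec =
  "((('h \<Rightarrow> complex) list \<Rightarrow> complex) set \<times> ('h set list \<Rightarrow> complex) set \<Rightarrow> complex) set"

definition quillen_fibre :: "('h::chilbert \<Rightarrow>\<^sub>L 'h) \<Rightarrow> 'h quillen_vec cvs" where
  "quillen_fibre T = tensor (ext_power (vdim (Ker T)) (vdual (Ker T)))
                            (ext_power (vdim (Coker T)) (Coker T))"

definition dual_basis :: "'a cvs \<Rightarrow> 'a list \<Rightarrow> ('a \<Rightarrow> complex) list" where
  "dual_basis V es = map (\<lambda>i. THE f. f \<in> vcarrier (vdual V) \<and>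
     (\<forall>j<length es. f (es ! j) = (if j = i then 1 else 0))) [0..<length es]"

text \<open>The auxiliary data entering the definition of \<open>\<phi>\<^sub>T\<close>: \<open>A \<in> \<A>\<^sub>T\<close>, a basis of the kernel, and
  a linear lift \<open>L\<close> of an isomorphism from the kernel to the cokernel.\<close>

definition phi_data ::
  "('h::chilbert \<Rightarrow>\<^sub>L 'h) \<Rightarrow> ('h \<Rightarrow>\<^sub>L 'h) \<Rightarrow> 'h list \<Rightarrow> ('h \<Rightarrow> 'h) \<Rightarrow> bool" where
  "phi_data T A es L \<longleftrightarrow> A \<in> quillen_A T \<and> distinct es \<and> vbasis (Ker T) (set es) \<and>
     vlinear (Ker T) hspace L \<and>
     bij_betw (coker_proj T \<circ> L) (vcarrier (Ker T)) (vcarrier (Coker T))"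

definition phi_value ::
  "('h::chilbert \<Rightarrow>\<^sub>L 'h) \<Rightarrow> ('h \<Rightarrow>\<^sub>L 'h) \<Rightarrow> 'h list \<Rightarrow> ('h \<Rightarrow> 'h) \<Rightarrow>
     (('h \<Rightarrow>\<^sub>L 'h) \<Rightarrow> complex) \<Rightarrow> 'h quillen_vec" where
  "phi_value T A es L f = vscale (quillen_fibre T)
     (f A * det_F (blinfun_apply (T + A) \<circ>
        inv (\<lambda>x. blinfun_apply T x + L (orth_proj (vcarrier (Ker T)) x))))
     (ptensor (ext_power (vdim (Ker T)) (vdual (Ker T)))
              (ext_power (vdim (Coker T)) (Coker T))
        (wedge (vdual (Ker T)) (dual_basis (Ker T) es))
        (wedge (Coker T) (map (coker_proj T \<circ> L) es)))"

text \<open>For \<open>f\<close> in \<open>quillen_D T\<close> the value does not depend on the chosen data.\<close>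

definition quillen_phi ::
  "('h::chilbert \<Rightarrow>\<^sub>L 'h) \<Rightarrow> (('h \<Rightarrow>\<^sub>L 'h) \<Rightarrow> complex) \<Rightarrow> 'h quillen_vec" where
  "quillen_phi T = (case (SOME (A, es, L). phi_data T A es L) of (A, es, L) \<Rightarrow> phi_value T A es L)"

definition quillen_triv ::
  "('h::chilbert \<Rightarrow>\<^sub>L 'h) \<Rightarrow> ('h \<Rightarrow>\<^sub>L 'h) \<times> complex \<Rightarrow> ('h \<Rightarrow>\<^sub>L 'h) \<times> 'h quillen_vec" where
  "quillen_triv A = (\<lambda>(T, z). (T, quillen_phi T (THE f. f \<in> quillen_D T \<and> f A = z)))"

definition quillen_total :: "(('h::chilbert \<Rightarrow>\<^sub>L 'h) \<times> 'h quillen_vec) set" where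
  "quillen_total = (SIGMA T:Fredholm0. vcarrier (quillen_fibre T))"

text \<open>The gluing topology: a set is open iff it is open in each local trivialization.\<close>

definition quillen_open :: "(('h::chilbert \<Rightarrow>\<^sub>L 'h) \<times> 'h quillen_vec) set \<Rightarrow> bool" where
  "quillen_open W \<longleftrightarrow> W \<subseteq> quillen_total \<and>
     (\<forall>A\<in>trace_class. openin (top_of_set (quillen_U A \<times> UNIV))
        {p \<in> quillen_U A \<times> UNIV. quillen_triv A p \<in> W})"

lemma istopology_quillen_open:
  "istopology (quillen_open :: (('h::chilbert \<Rightarrow>\<^sub>L 'h) \<times> 'h quillen_vec) set \<Rightarrow> bool)"
  unfolding istopology_def
proof (intro conjI allI impI)
  fix S T :: "(('h \<Rightarrow>\<^sub>L 'h) \<times> 'h quillen_vec) set"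
  assume S: "quillen_open S" and T: "quillen_open T"
  have "{p \<in> quillen_U A \<times> UNIV. quillen_triv A p \<in> S \<inter> T} =
      {p \<in> quillen_U A \<times> UNIV. quillen_triv A p \<in> S} \<inter>
      {p \<in> quillen_U A \<times> UNIV. quillen_triv A p \<in> T}" for A
    by blast
  then show "quillen_open (S \<inter> T)"
    using S T unfolding quillen_open_def by (auto simp only: intro!: openin_Int)
next
  fix \<K> :: "(('h \<Rightarrow>\<^sub>L 'h) \<times> 'h quillen_vec) set set"
  assume K: "\<forall>K\<in>\<K>. quillen_open K"
  have "{p \<in> quillen_U A \<times> UNIV. quillen_triv A p \<in> \<Union>\<K>} =
      (\<Union>K\<in>\<K>. {p \<in> quillen_U A \<times> UNIV. quillen_triv A p \<in> K})" for A
    by blast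
  then show "quillen_open (\<Union>\<K>)"
    using K unfolding quillen_open_def by (auto simp only: intro!: openin_Union)
qed

definition quillen_topology :: "(('h::chilbert \<Rightarrow>\<^sub>L 'h) \<times> 'h quillen_vec) topology" where
  "quillen_topology = topology quillen_open"

text \<open>A complex line bundle over \<open>X\<close> with fibres \<open>Fib x\<close> and total space topology \<open>E\<close> on pairs
  \<open>(x, v)\<close> is trivial if it is isomorphic to the product bundle: there is a fibrewise
  linear homeomorphism over \<open>X\<close>.\<close>

definition trivial_line_bundle :: "'b topology \<Rightarrow> ('b \<Rightarrow> 'v cvs) \<Rightarrow> ('b \<times> 'v) topology \<Rightarrow> bool" where
  "trivial_line_bundle X Fib E \<longleftrightarrow>
     (\<exists>\<Phi>. (\<forall>x\<in>topspace X. vlinear cline (Fib x) (\<Phi> x)) \<and>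
        homeomorphic_map (prod_topology X (euclidean :: complex topology)) E
          (\<lambda>(x, z). (x, \<Phi> x z)))"

end

theory Submission
  imports Defs
begin

text \<open>A trivialization compares the constant section with the local sections over the \<open>\<U>\<^sub>A\<close>; this
  gives continuous nowhere zero functions \<open>h\<^sub>A\<close> on \<open>\<U>\<^sub>A\<close> with
  \<open>h\<^sub>A(T) = det\<^sub>F((T + A)(T + B)\<^sup>-\<^sup>1) h\<^sub>B(T)\<close>. Let \<open>p\<close> be the projection onto a unit vector,
  \<open>T\<^sub>w = 1 + (w - 1)p\<close> and \<open>A = 2p\<close>. The closed unit disc maps into \<open>\<U>\<^sub>A\<close>, so
  \<open>h\<^sub>A(T\<^sub>w)\<close> has winding number 0 on the unit circle, whereas \<open>h\<^sub>A(T\<^sub>w) = (w + 2)/w h\<^sub>0(T\<^sub>w)\<close>.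
  Hence \<open>h\<^sub>0(T\<^sub>w)\<close> has winding number 1; but in infinite dimension the loop \<open>T\<^sub>w\<close> is
  null-homotopic in \<open>\<U>\<^sub>0 = GL(H)\<close>, by an Eilenberg swindle.\<close>

section \<open>Orthonormal families\<close>

text \<open>In finite dimension, h_A(T) = det(T + A) satisfies all these relations, and its h_0 has
  winding number 1 on the loop. The contradiction therefore has to come from the topology of GL(H).
  Infinite dimension enters as a countably infinite orthonormal family, taken from a maximal
  orthonormal set that may be uncountable; hence all expansions are unordered sums. The second chart
  is forced by the centre of the disc: T_0 has a one-dimensional kernel, so the loop cannot be
  filled by this disc inside U_0. On the bundle side the obstacle is that phi_T and the local
  trivializations are given by choice and description operators, whose good behaviour rests on
  properties of determinants. The assumed trivialization is made to supply what is missing, namely a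
  generator of each line D_T, and the only determinants evaluated are those of rank one
  perturbations of the identity. Winding numbers are handled through logarithms: a logarithm of h_0
  on the loop and one of (w + 2) / h_A on the disc add up to a continuous logarithm of w on the
  circle.\<close>

lemma scaleC_one [simp]: "(1::complex) *\<^sub>C (x::'a::chilbert) = x"
  using scaleR_scaleC[of 1 x] by simp

lemma scaleC_zero_left [simp]: "(0::complex) *\<^sub>C (x::'a::chilbert) = 0"
  using scaleR_scaleC[of 0 x] by simp

lemma scaleC_zero_right [simp]: "c *\<^sub>C (0::'a::chilbert) = 0"
  using scaleC_add_right[of c 0 0] by simp

lemma scaleC_minus_right: "c *\<^sub>C (- x::'a::chilbert) = - (c *\<^sub>C x)"
  using scaleC_add_right[of c x "-x"] by (simp add: eq_neg_iff_add_eq_0 add.commute)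

lemma scaleC_minus_left: "(- c) *\<^sub>C (x::'a::chilbert) = - (c *\<^sub>C x)"
  using scaleC_add_left[of c "-c" x] by (simp add: eq_neg_iff_add_eq_0 add.commute)

lemma scaleC_diff_right: "c *\<^sub>C (x - y::'a::chilbert) = c *\<^sub>C x - c *\<^sub>C y"
  using scaleC_add_right[of c x "-y"] by (simp add: scaleC_minus_right)

lemma scaleC_diff_left: "(c - d) *\<^sub>C (x::'a::chilbert) = c *\<^sub>C x - d *\<^sub>C x"
  using scaleC_add_left[of c "-d" x] by (simp add: scaleC_minus_left)

lemma scaleC_eq_0_iff [simp]: "c *\<^sub>C (x::'a::chilbert) = 0 \<longleftrightarrow> c = 0 \<or> x = 0"
proof
  assume "c *\<^sub>C x = 0"
  then have "(inverse c * c) *\<^sub>C x = 0" by (simp flip: scaleC_scaleC)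
  then show "c = 0 \<or> x = 0" by (cases "c = 0") auto
qed auto

lemma cinner_add_left: "cinner (x + y) (z::'a::chilbert) = cinner x z + cinner y z"
  by (subst (1 2 3) cinner_commute) (simp add: cinner_add_right)

lemma cinner_scaleC_left: "cinner (c *\<^sub>C x) (y::'a::chilbert) = cnj c * cinner x y"
  by (subst (1 2) cinner_commute) (simp add: cinner_scaleC_right)

lemma cinner_zero_right [simp]: "cinner x (0::'a::chilbert) = 0"
  using cinner_add_right[of x 0 0] by simp

lemma cinner_zero_left [simp]: "cinner (0::'a::chilbert) x = 0"
  using cinner_add_left[of 0 0 x] by simp

lemma cinner_minus_right: "cinner x (- y::'a::chilbert) = - cinner x y"
  using cinner_add_right[of x y "-y"] by (simp add: eq_neg_iff_add_eq_0 add.commute)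

lemma cinner_diff_right: "cinner x (y - z::'a::chilbert) = cinner x y - cinner x z"
  using cinner_add_right[of x y "-z"] by (simp add: cinner_minus_right)

lemma cinner_sum_right: "cinner x (\<Sum>i\<in>F. f i :: 'a::chilbert) = (\<Sum>i\<in>F. cinner x (f i))"
  by (induction F rule: infinite_finite_induct) (auto simp: cinner_add_right)

lemma norm_scaleC: "norm (c *\<^sub>C (x::'a::chilbert)) = cmod c * norm x"
proof -
  have "complex_of_real ((norm (c *\<^sub>C x))\<^sup>2) = complex_of_real ((cmod c * norm x)\<^sup>2)"
    unfolding cinner_self[symmetric] cinner_scaleC_left cinner_scaleC_right
    using complex_norm_square[of c] by (simp add: cinner_self power_mult_distrib)
  then have "(norm (c *\<^sub>C x))\<^sup>2 = (cmod c * norm x)\<^sup>2" using of_real_eq_iff by blast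
  then show ?thesis by (simp add: power2_eq_iff_nonneg)
qed

lemma bounded_linear_scaleC_right: "bounded_linear (\<lambda>x::'a::chilbert. c *\<^sub>C x)"
  by (rule bounded_linear_intro[of _ "cmod c"])
    (auto simp: scaleC_add_right scaleR_scaleC scaleC_scaleC norm_scaleC mult.commute)

lemma bounded_bilinear_scaleC: "bounded_bilinear (\<lambda>c (x::'a::chilbert). c *\<^sub>C x)"
  by (rule bounded_bilinear.intro)
    (auto simp: scaleC_add_left scaleC_add_right scaleR_scaleC scaleC_scaleC norm_scaleC
      scaleR_conv_of_real mult.commute intro!: exI[of _ 1])

lemma Pythagoras_cinner:
  assumes "cinner x (y::'a::chilbert) = 0"
  shows "(norm (x + y))\<^sup>2 = (norm x)\<^sup>2 + (norm y)\<^sup>2"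
proof -
  have "cinner y x = 0" using assms cinner_commute[of y x] by simp
  then have "complex_of_real ((norm (x + y))\<^sup>2) = complex_of_real ((norm x)\<^sup>2 + (norm y)\<^sup>2)"
    using assms unfolding of_real_add cinner_self[symmetric]
    by (simp add: cinner_add_left cinner_add_right)
  then show ?thesis using of_real_eq_iff by blast
qed

text \<open>Pythagoras for the component of \<open>y\<close> along \<open>x\<close> and its
  orthogonal remainder.\<close>

lemma cinner_bounded: "cmod (cinner x (y::'a::chilbert)) \<le> norm x * norm y"
proof (cases "x = 0")
  case False
  define c where "c = cinner x y / (norm x)\<^sup>2"
  have n: "norm x > 0" using False by simp
  have "cinner x (y - c *\<^sub>C x) = 0"
    using n by (simp add: cinner_diff_right cinner_scaleC_right cinner_self c_def)
  then have "cinner (c *\<^sub>C x) (y - c *\<^sub>C x) = 0" by (simp add: cinner_scaleC_left)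
  from Pythagoras_cinner[OF this] have "(norm y)\<^sup>2 = (norm (c *\<^sub>C x))\<^sup>2 + (norm (y - c *\<^sub>C x))\<^sup>2" by simp
  then have "(norm (c *\<^sub>C x))\<^sup>2 \<le> (norm y)\<^sup>2" by simp
  then have "norm (c *\<^sub>C x) \<le> norm y" by (simp add: power2_le_iff_abs_le)
  moreover have "norm (c *\<^sub>C x) = cmod (cinner x y) / norm x"
    using n by (simp add: norm_scaleC c_def norm_divide norm_mult power2_eq_square)
  ultimately show ?thesis using n by (simp add: divide_le_eq mult.commute)
qed simp

lemma bounded_linear_cinner: "bounded_linear (\<lambda>y::'a::chilbert. cinner x y)"
  by (rule bounded_linear_intro[of _ "norm x"])
    (auto simp: cinner_add_right scaleR_scaleC cinner_scaleC_right scaleR_conv_of_real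
      mult.commute[of _ "norm x"] cinner_bounded)

section \<open>Expansions in orthonormal families\<close>

definition orthonormal :: "'i set \<Rightarrow> ('i \<Rightarrow> 'a::chilbert) \<Rightarrow> bool" where
  "orthonormal J b \<longleftrightarrow> (\<forall>i\<in>J. \<forall>j\<in>J. cinner (b i) (b j) = (if i = j then 1 else 0))"

lemma norm_eq_1_if_cinner_self:
  assumes "cinner x x = 1"
  shows "norm (x::'a::chilbert) = 1"
proof -
  have "complex_of_real ((norm x)\<^sup>2) = complex_of_real 1" using assms cinner_self[of x] by simp
  then have "(norm x)\<^sup>2 = 1" unfolding of_real_eq_iff .
  then show ?thesis using norm_ge_zero[of x] unfolding power2_eq_1_iff by linarith
qed

lemma norm_orthonormal: "orthonormal J b \<Longrightarrow> i \<in> J \<Longrightarrow> norm (b i) = 1"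
  by (rule norm_eq_1_if_cinner_self) (simp add: orthonormal_def)

lemma norm_sum_orthonormal:
  assumes "orthonormal J b" "finite F" "F \<subseteq> J"
  shows "(norm (\<Sum>i\<in>F. c i *\<^sub>C b i))\<^sup>2 = (\<Sum>i\<in>F. (cmod (c i))\<^sup>2)"
  using assms(2,3)
proof (induction F)
  case (insert i F)
  have "cinner (b i) (b j) = 0" if "j \<in> F" for j
  proof -
    have "i \<noteq> j" "i \<in> J" "j \<in> J" using insert that by auto
    then show ?thesis using assms(1) by (simp add: orthonormal_def)
  qed
  then have "cinner (c i *\<^sub>C b i) (\<Sum>i\<in>F. c i *\<^sub>C b i) = 0"
    unfolding cinner_sum_right by (simp add: cinner_scaleC_left cinner_scaleC_right)
  moreover have "norm (b i) = 1" using norm_orthonormal[OF assms(1)] insert by simp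
  ultimately show ?case using insert Pythagoras_cinner[of "c i *\<^sub>C b i" "\<Sum>i\<in>F. c i *\<^sub>C b i"]
    by (simp add: norm_scaleC)
qed simp

lemma cinner_sum_orthonormal:
  assumes "orthonormal J b" "finite F" "F \<subseteq> J" "i \<in> F"
  shows "cinner (b i) (\<Sum>j\<in>F. c j *\<^sub>C b j) = c i"
proof -
  have "cinner (b i) (\<Sum>j\<in>F. c j *\<^sub>C b j) = (\<Sum>j\<in>F. if j = i then c i else 0)"
    using assms unfolding cinner_sum_right
    by (intro sum.cong refl) (auto simp: cinner_scaleC_right orthonormal_def subset_iff)
  then show ?thesis using assms by simp
qed

lemma Bessel_inequality:
  assumes b: "orthonormal J b" and F: "finite F" "F \<subseteq> J"
  shows "(\<Sum>i\<in>F. (cmod (cinner (b i) x))\<^sup>2) \<le> (norm x)\<^sup>2"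
proof -
  let ?y = "\<Sum>i\<in>F. cinner (b i) x *\<^sub>C b i"
  have "cinner (x - ?y) (b i) = 0" if "i \<in> F" for i
    using cinner_sum_orthonormal[OF b F that, of "\<lambda>i. cinner (b i) x"] cinner_commute[of "x - ?y" "b i"]
    by (simp add: cinner_diff_right)
  then have "cinner (x - ?y) ?y = 0"
    unfolding cinner_sum_right by (simp add: cinner_scaleC_right)
  from Pythagoras_cinner[OF this] have "(norm x)\<^sup>2 = (norm (x - ?y))\<^sup>2 + (norm ?y)\<^sup>2" by simp
  then have "(norm ?y)\<^sup>2 \<le> (norm x)\<^sup>2" by simp
  then show ?thesis by (simp add: norm_sum_orthonormal[OF b F])
qed

text \<open>The Riesz-Fischer theorem for unordered sums: by Pythagoras, distances between finite
  partial sums are controlled by the convergent series of squares, so the partial sums form a Cauchy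
  filter in a complete space.\<close>

lemma summable_on_orthonormal:
  fixes b :: "'i \<Rightarrow> 'a::chilbert"
  assumes b: "orthonormal J b"
    and bound: "\<And>F. finite F \<Longrightarrow> F \<subseteq> J \<Longrightarrow> (\<Sum>i\<in>F. (cmod (c i))\<^sup>2) \<le> C"
  shows "(\<lambda>i. c i *\<^sub>C b i) summable_on J"
proof -
  let ?q = "\<lambda>i. (cmod (c i))\<^sup>2" and ?f = "\<lambda>i. c i *\<^sub>C b i"
  have "?q summable_on J"
    by (rule nonneg_bounded_partial_sums_imp_summable_on[of _ _ C])
      (auto intro!: eventually_finite_subsets_at_top_weakI bound)
  then obtain s where s: "(sum ?q \<longlongrightarrow> s) (finite_subsets_at_top J)"
    by (auto simp: summable_on_def has_sum_def)
  have "\<exists>P. eventually P (finite_subsets_at_top J) \<and>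
      (\<forall>F F'. P F \<and> P F' \<longrightarrow> dist (sum ?f F) (sum ?f F') < e)" if e: "e > 0" for e
  proof -
    \<comment> \<open>Two sums of squares that are both this close to \<open>s\<close> differ by
      less than e^2/4 = (e/2)^2, so each vector sum is within e/2 of the one over
      \<open>F0\<close>.\<close>
    have d: "e\<^sup>2 / 8 > 0" using e by simp
    obtain F0 where F0: "finite F0" "F0 \<subseteq> J"
      and near0: "\<forall>F. finite F \<and> F0 \<subseteq> F \<and> F \<subseteq> J \<longrightarrow> dist (sum ?q F) s < e\<^sup>2 / 8"
      using tendstoD[OF s d] unfolding eventually_finite_subsets_at_top by (elim exE conjE) (rule that)
    have near: "dist (sum ?f F) (sum ?f F0) < e / 2" if F: "finite F" "F0 \<subseteq> F" "F \<subseteq> J" for F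
    proof -
      have "sum ?f F - sum ?f F0 = sum ?f (F - F0)" "sum ?q F - sum ?q F0 = sum ?q (F - F0)"
        using F by (simp_all add: sum_diff)
      moreover have "\<bar>sum ?q F - s\<bar> < e\<^sup>2 / 8" "\<bar>sum ?q F0 - s\<bar> < e\<^sup>2 / 8"
        using near0[rule_format, of F] near0[rule_format, of F0] F F0 by (simp_all add: dist_real_def)
      then have "sum ?q F - sum ?q F0 < e\<^sup>2 / 4"
        by linarith
      ultimately have "(norm (sum ?f F - sum ?f F0))\<^sup>2 < (e / 2)\<^sup>2"
        using norm_sum_orthonormal[OF b finite_Diff[OF F(1)], of F0 c] order_trans[OF Diff_subset F(3), of F0]
        by (simp add: power_divide)
      then show ?thesis unfolding dist_norm by (rule power_less_imp_less_base) (use e in simp)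
    qed
    show ?thesis
    proof (intro exI[of _ "\<lambda>F. finite F \<and> F0 \<subseteq> F \<and> F \<subseteq> J"] conjI allI impI)
      show "\<forall>\<^sub>F F in finite_subsets_at_top J. finite F \<and> F0 \<subseteq> F \<and> F \<subseteq> J"
        using F0 by (auto simp: eventually_finite_subsets_at_top)
      fix F F' assume "(finite F \<and> F0 \<subseteq> F \<and> F \<subseteq> J) \<and> (finite F' \<and> F0 \<subseteq> F' \<and> F' \<subseteq> J)"
      then show "dist (sum ?f F) (sum ?f F') < e"
        using near[of F] near[of F'] dist_triangle2[of "sum ?f F" "sum ?f F'" "sum ?f F0"] by simp
    qed
  qed
  then have "cauchy_filter (filtermap (sum ?f) (finite_subsets_at_top J))"
    by (simp add: cauchy_filter_metric_filtermap)
  moreover have "complete (UNIV::'a set)"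
    by (meson Cauchy_convergent UNIV_I complete_def convergent_def)
  ultimately obtain L where "(sum ?f \<longlongrightarrow> L) (finite_subsets_at_top J)"
    using complete_uniform[where S=UNIV] by (force simp: filterlim_def)
  then show ?thesis
    using summable_on_def has_sum_def by blast
qed

lemma has_sum_orthonormal_cinner:
  assumes b: "orthonormal J b" and y: "((\<lambda>i. c i *\<^sub>C b i) has_sum y) J" and i: "i \<in> J"
  shows "cinner (b i) y = c i"
proof -
  have "((\<lambda>j. cinner (b i) (c j *\<^sub>C b j)) has_sum cinner (b i) y) J"
    by (rule has_sum_bounded_linear[OF bounded_linear_cinner y])
  then have "((\<lambda>j. if j = i then c i else 0) has_sum cinner (b i) y) J"
    by (rule has_sum_cong[THEN iffD1, rotated])
      (use b i in \<open>auto simp: cinner_scaleC_right orthonormal_def\<close>)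
  moreover have "((\<lambda>j. if j = i then c i else 0) has_sum c i) J"
    using has_sum_finite_neutralI[of "{i}" J "\<lambda>j. if j = i then c i else 0" "c i"] i by simp
  ultimately show ?thesis by (rule has_sum_unique)
qed

lemma has_sum_cinner_orthogonal:
  assumes "((\<lambda>i. c i *\<^sub>C b i) has_sum y) J" "\<And>i. i \<in> J \<Longrightarrow> cinner z (b i) = 0"
  shows "cinner z (y::'a::chilbert) = 0"
proof -
  have "((\<lambda>j. cinner z (c j *\<^sub>C b j)) has_sum cinner z y) J"
    by (rule has_sum_bounded_linear[OF bounded_linear_cinner assms(1)])
  then have "((\<lambda>j. 0) has_sum cinner z y) J"
    by (rule has_sum_cong[THEN iffD1, rotated]) (use assms(2) in \<open>auto simp: cinner_scaleC_right\<close>)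
  then show ?thesis by (rule has_sum_unique) simp
qed

text \<open>For orthonormal families this is the partial isometry that sends each \<open>a i\<close>
  to \<open>b i\<close> and vanishes on the vectors orthogonal to all \<open>a i\<close>; for
  \<open>a = b\<close> it is the orthogonal projection onto the closed span. Such operators serve
  below as matrix units with infinite blocks.\<close>

definition Transfer :: "'i set \<Rightarrow> ('i \<Rightarrow> 'a::chilbert) \<Rightarrow> ('i \<Rightarrow> 'a) \<Rightarrow> 'a \<Rightarrow>\<^sub>L 'a" where
  "Transfer J a b = Blinfun (\<lambda>x. infsum (\<lambda>i. cinner (a i) x *\<^sub>C b i) J)"

text \<open>Bessel's inequality yields both the summability of the series and the norm bound 1, so
  that \<open>Blinfun\<close> in the definition is applied to a bounded linear map.\<close>

lemma has_sum_transfer: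
  assumes a: "orthonormal J a" and b: "orthonormal J b"
  shows "((\<lambda>i. cinner (a i) x *\<^sub>C b i) has_sum blinfun_apply (Transfer J a b) x) J"
proof -
  let ?T = "\<lambda>x. infsum (\<lambda>i. cinner (a i) x *\<^sub>C b i) J"
  have sum: "(\<lambda>i. cinner (a i) x *\<^sub>C b i) summable_on J" for x
    by (rule summable_on_orthonormal[OF b Bessel_inequality[OF a]])
  then have hs: "((\<lambda>i. cinner (a i) x *\<^sub>C b i) has_sum ?T x) J" for x by simp
  have "bounded_linear ?T"
  proof (rule bounded_linear_intro[of _ 1])
    fix x y r
    show "?T (x + y) = ?T x + ?T y"
      using has_sum_add[OF hs hs] by (intro infsumI) (simp add: cinner_add_right scaleC_add_left)
    show "?T (r *\<^sub>R x) = r *\<^sub>R ?T x"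
      using has_sum_bounded_linear[OF bounded_linear_scaleC_right hs, of "of_real r" x]
      by (intro infsumI) (simp add: scaleR_scaleC cinner_scaleC_right scaleC_scaleC)
    have "((\<lambda>F. norm (\<Sum>i\<in>F. cinner (a i) x *\<^sub>C b i)) \<longlongrightarrow> norm (?T x)) (finite_subsets_at_top J)"
      using hs[of x] unfolding has_sum_def by (rule tendsto_norm)
    then have "norm (?T x) \<le> norm x"
    proof (rule tendsto_upperbound)
      show "\<forall>\<^sub>F F in finite_subsets_at_top J. norm (\<Sum>i\<in>F. cinner (a i) x *\<^sub>C b i) \<le> norm x"
        by (rule eventually_finite_subsets_at_top_weakI, rule power2_le_imp_le)
          (simp_all add: norm_sum_orthonormal[OF b] Bessel_inequality[OF a])
    qed auto
    then show "norm (?T x) \<le> norm x * 1" by simp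
  qed
  then show ?thesis using hs unfolding Transfer_def by (simp add: bounded_linear_Blinfun_apply)
qed

lemma Transfer_scaleC:
  assumes a: "orthonormal J a" and b: "orthonormal J b"
  shows "Transfer J a b (c *\<^sub>C x) = c *\<^sub>C Transfer J a b x"
proof (rule has_sum_unique[OF has_sum_transfer[OF a b]])
  show "((\<lambda>i. cinner (a i) (c *\<^sub>C x) *\<^sub>C b i) has_sum c *\<^sub>C Transfer J a b x) J"
    using has_sum_bounded_linear[OF bounded_linear_scaleC_right has_sum_transfer[OF a b], of c x]
    by (simp add: cinner_scaleC_right scaleC_scaleC)
qed

lemma Transfer_compose:
  assumes "orthonormal J a" "orthonormal J b" "orthonormal J c"
  shows "Transfer J b c o\<^sub>L Transfer J a b = Transfer J a c"
proof (rule blinfun_eqI)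
  fix x
  have "cinner (b i) (Transfer J a b x) = cinner (a i) x" if "i \<in> J" for i
    using has_sum_orthonormal_cinner[OF assms(2) has_sum_transfer[OF assms(1,2)] that] .
  then have "((\<lambda>i. cinner (a i) x *\<^sub>C c i) has_sum Transfer J b c (Transfer J a b x)) J"
    by (intro has_sum_cong[THEN iffD1, OF _ has_sum_transfer[OF assms(2,3)]]) simp
  then show "blinfun_apply (Transfer J b c o\<^sub>L Transfer J a b) x = Transfer J a c x"
    using has_sum_unique[OF _ has_sum_transfer[OF assms(1,3)]] by simp
qed

lemma Transfer_compose_orthogonal:
  assumes "orthonormal J a" "orthonormal J b" "orthonormal K b'" "orthonormal K c"
    and "\<And>i j. i \<in> J \<Longrightarrow> j \<in> K \<Longrightarrow> cinner (b' j) (b i) = 0"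
  shows "Transfer K b' c o\<^sub>L Transfer J a b = 0"
proof (rule blinfun_eqI)
  fix x
  have "cinner (b' j) (Transfer J a b x) = 0" if "j \<in> K" for j
    by (rule has_sum_cinner_orthogonal[OF has_sum_transfer[OF assms(1,2)]]) (use assms(5) that in auto)
  then have "((\<lambda>i. 0) has_sum Transfer K b' c (Transfer J a b x)) K"
    by (intro has_sum_cong[THEN iffD1, OF _ has_sum_transfer[OF assms(3,4)]]) simp
  then show "blinfun_apply (Transfer K b' c o\<^sub>L Transfer J a b) x = blinfun_apply 0 x"
    using has_sum_unique[OF _ has_sum_0[OF refl]] by simp
qed

section \<open>Spans and orthonormal bases\<close>

lemma hspan_zero: "0 \<in> vspan hspace (S::'a::chilbert set)"
  unfolding vspan_def hull_def
proof (clarify)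
  fix W :: "'a set" assume W: "vsubspace hspace W"
  then obtain x where "x \<in> W" by (auto simp: vsubspace_def)
  then have "0 *\<^sub>C x \<in> W" using W unfolding vsubspace_def hspace_def by (metis cvs.select_convs(3))
  then show "0 \<in> W" by simp
qed

lemma hspan_add: "x \<in> vspan hspace S \<Longrightarrow> y \<in> vspan hspace S \<Longrightarrow> x + y \<in> vspan hspace S"
  unfolding vspan_def hull_def vsubspace_def by (simp add: hspace_def)

lemma hspan_scaleC: "x \<in> vspan hspace S \<Longrightarrow> c *\<^sub>C x \<in> vspan hspace S"
  unfolding vspan_def hull_def vsubspace_def by (simp add: hspace_def)

lemma hspan_base: "x \<in> S \<Longrightarrow> x \<in> vspan hspace S"
  unfolding vspan_def by (rule hull_inc)

lemma hspan_sum: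
  assumes "finite F" "F \<subseteq> S"
  shows "(\<Sum>e\<in>F. c e *\<^sub>C e) \<in> vspan hspace S"
  using assms by (induction F) (simp_all add: hspan_zero hspan_add hspan_scaleC hspan_base)

text \<open>The remainder of \<open>x\<close> after projection to the closed span of
  \<open>E\<close> is orthogonal to \<open>E\<close>, hence zero, so \<open>x\<close> is a limit of
  finite combinations. The definition of \<open>trace_class\<close> asks for such a basis.\<close>

lemma orthonormal_basis_if_maximal:
  fixes E :: "'a::chilbert set"
  assumes E: "orthonormal E id" and max: "\<And>x. (\<And>e. e \<in> E \<Longrightarrow> cinner e x = 0) \<Longrightarrow> x = 0"
  shows "orthonormal_basis E"
proof -
  have "x \<in> closure (vspan hspace E)" for x
  proof -
    let ?P = "Transfer E id id"
    have "x - ?P x = 0"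
    proof (rule max)
      fix e assume "e \<in> E"
      then have "cinner (id e) (?P x) = cinner (id e) x"
        by (rule has_sum_orthonormal_cinner[OF E has_sum_transfer[OF E E]])
      then show "cinner e (x - ?P x) = 0" by (simp add: cinner_diff_right)
    qed
    then have "((\<lambda>F. \<Sum>e\<in>F. cinner e x *\<^sub>C e) \<longlongrightarrow> x) (finite_subsets_at_top E)"
      using has_sum_transfer[OF E E, of x] by (simp add: has_sum_def)
    then show ?thesis
      by (rule Lim_in_closed_set[OF closed_closure, rotated 2])
        (auto intro!: eventually_finite_subsets_at_top_weakI subsetD[OF closure_subset] hspan_sum)
  qed
  then show ?thesis using E by (auto simp: orthonormal_basis_def orthonormal_def)
qed

lemma exists_maximal_orthonormal:
  obtains E :: "'a::chilbert set" where "orthonormal E id"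
    "\<forall>x. (\<forall>e\<in>E. cinner e x = 0) \<longrightarrow> x = 0"
proof -
  have "\<exists>M\<in>{E::'a set. orthonormal E id}. \<forall>X\<in>{E. orthonormal E id}. M \<subseteq> X \<longrightarrow> X = M"
  proof (rule subset_Zorn')
    fix C :: "'a set set" assume C: "subset.chain {E. orthonormal E id} C"
    have "cinner x y = (if x = y then 1 else 0)" if xy: "x \<in> \<Union>C" "y \<in> \<Union>C" for x y
    proof -
      obtain X Y where XY: "X \<in> C" "Y \<in> C" "x \<in> X" "y \<in> Y" using xy by blast
      then have "X \<subseteq> Y \<or> Y \<subseteq> X" using C unfolding subset.chain_def by blast
      then obtain Z where "Z \<in> C" "x \<in> Z" "y \<in> Z" using XY by blast
      moreover have "orthonormal Z id" using C \<open>Z \<in> C\<close> unfolding subset.chain_def by blast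
      ultimately show ?thesis unfolding orthonormal_def by simp
    qed
    then show "\<Union>C \<in> {E. orthonormal E id}" by (simp add: orthonormal_def)
  qed
  then obtain E :: "'a set" where E: "orthonormal E id"
    and max: "\<And>X. orthonormal X id \<Longrightarrow> E \<subseteq> X \<Longrightarrow> X = E" by blast
  show ?thesis
  proof (rule that[OF E], intro allI impI)
    fix x assume x: "\<forall>e\<in>E. cinner e x = 0"
    show "x = 0"
    proof (rule ccontr)
      assume "x \<noteq> 0"
      define u where "u = complex_of_real (1 / norm x) *\<^sub>C x"
      have uu: "cinner u u = 1"
        using \<open>x \<noteq> 0\<close> by (simp add: u_def cinner_self norm_scaleC norm_divide)
      have eu: "cinner e u = 0" "cinner u e = 0" if "e \<in> E" for e
        using x that cinner_commute[of u e] by (simp_all add: u_def cinner_scaleC_right)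
      have "orthonormal (insert u E) id"
        using E uu eu unfolding orthonormal_def by auto
      then have "u \<in> E" using max[of "insert u E"] by blast
      then show False using eu(1)[of u] uu by simp
    qed
  qed
qed

text \<open>Connects the algebraic dimension in the hypothesis of the theorem with orthonormal sets:
  a finite \<open>E\<close> would span, because finite expansions leave no remainder, and would be
  independent, because each member is orthogonal to the span of the others.\<close>

lemma infinite_if_maximal_orthonormal:
  fixes E :: "'a::chilbert set"
  assumes E: "orthonormal E id" and max: "\<And>x. (\<And>e. e \<in> E \<Longrightarrow> cinner e x = 0) \<Longrightarrow> x = 0"
    and inf: "\<not> vfinite_dim (hspace :: 'a cvs)"
  shows "infinite E"
proof
  assume fin: "finite E"
  have "x \<in> vspan hspace E" for x
  proof -
    have "x - (\<Sum>e\<in>E. cinner e x *\<^sub>C e) = 0"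
    proof (rule max)
      fix e assume "e \<in> E"
      then show "cinner e (x - (\<Sum>e\<in>E. cinner e x *\<^sub>C e)) = 0"
        using cinner_sum_orthonormal[OF E fin order_refl, of e "\<lambda>e. cinner e x"]
        by (simp add: cinner_diff_right)
    qed
    then show ?thesis using hspan_sum[OF fin order_refl, of "\<lambda>e. cinner e x"] by simp
  qed
  moreover have "b \<notin> vspan hspace (E - {b})" if b: "b \<in> E" for b
  proof
    assume "b \<in> vspan hspace (E - {b})"
    moreover have "vspan hspace (E - {b}) \<subseteq> {y. cinner b y = 0}"
      unfolding vspan_def
    proof (rule hull_minimal)
      show "E - {b} \<subseteq> {y. cinner b y = 0}" using E b by (auto simp: orthonormal_def)
      have "0 \<in> {y. cinner b y = 0}" by simp
      then show "vsubspace hspace {y. cinner b y = 0}"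
        unfolding vsubspace_def
        by (auto simp: hspace_def cinner_add_right cinner_scaleC_right intro: exI[of _ 0])
    qed
    ultimately have "cinner b b = 0" by blast
    then show False using E b by (auto simp: orthonormal_def)
  qed
  ultimately have "vbasis hspace E" unfolding vbasis_def by (auto simp: hspace_def)
  then show False using inf fin by (auto simp: vfinite_dim_def)
qed

section \<open>Rank one perturbations of the identity\<close>

lemma vdim_singleton:
  assumes V: "vcarrier V = {z}" "vadd V z z = z" "\<And>c. vscale V c z = z"
  shows "vfinite_dim V" "vdim V = 0"
proof -
  have sub: "vsubspace V t \<longleftrightarrow> t = {z}" for t
  proof
    assume "vsubspace V t"
    then have "t \<subseteq> {z}" "t \<noteq> {}" using V(1) by (simp_all add: vsubspace_def)
    then show "t = {z}" by blast
  qed (use V in \<open>simp add: vsubspace_def\<close>)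
  have span: "vspan V {} = {z}" unfolding vspan_def hull_def sub by simp
  have B: "vbasis V B \<longleftrightarrow> B = {}" for B
  proof
    assume B: "vbasis V B"
    have sub: "B \<subseteq> {z}" using B V(1) by (simp add: vbasis_def)
    have "z \<notin> B"
    proof
      assume z: "z \<in> B"
      then have B0: "B - {z} = {}" using sub by blast
      have "z \<notin> vspan V (B - {z})" using B z unfolding vbasis_def by blast
      then show False unfolding B0 span by simp
    qed
    then show "B = {}" using sub by blast
  qed (use V span in \<open>simp add: vbasis_def\<close>)
  show "vfinite_dim V" unfolding vfinite_dim_def B by simp
  show "vdim V = 0" using B by (simp add: vdim_def)
qed

text \<open>\<open>vdim\<close> is the size of a basis selected by choice, so the size of every
  basis has to be determined. The coordinate \<open>g\<close> lets one lemma serve the kernel and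
  the cokernel of \<open>dilation u 0\<close> and a generalized eigenspace.\<close>

lemma vdim_line:
  assumes g: "bij_betw g UNIV (vcarrier V)" and add: "\<And>a b. vadd V (g a) (g b) = g (a + b)"
    and scale: "\<And>c a. vscale V c (g a) = g (c * a)"
  shows "vfinite_dim V" "vdim V = 1"
proof -
  have car: "vcarrier V = range g" using g by (simp add: bij_betw_def)
  have inj: "g a = g b \<longleftrightarrow> a = b" for a b using g by (auto simp: bij_betw_def inj_on_def)
  have sub0: "vsubspace V {g 0}" using car by (auto simp: vsubspace_def add scale)
  have subV: "vsubspace V (vcarrier V)" using car by (auto simp: vsubspace_def add scale)
  have full: "t = vcarrier V" if t: "vsubspace V t" "g a \<in> t" "a \<noteq> 0" for t a
  proof -
    have "g c \<in> t" for c
    proof -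
      have "vscale V (c / a) (g a) \<in> t" using t(1,2) unfolding vsubspace_def by blast
      then show ?thesis using t(3) by (simp add: scale)
    qed
    then show ?thesis using t(1) car by (auto simp: vsubspace_def)
  qed
  have span: "vspan V S = vcarrier V" if S: "S \<subseteq> vcarrier V" "g a \<in> S" "a \<noteq> 0" for S a
  proof
    show "vspan V S \<subseteq> vcarrier V" unfolding vspan_def by (rule hull_minimal[OF S(1), where S = "vsubspace V", OF subV])
    show "vcarrier V \<subseteq> vspan V S" unfolding vspan_def hull_def using full S by blast
  qed
  have span0: "vspan V S \<subseteq> {g 0}" if "S \<subseteq> {g 0}" for S
    unfolding vspan_def by (rule hull_minimal[OF that, where S = "vsubspace V", OF sub0])
  have card: "card B = 1" if B: "vbasis V B" for B
  proof -
    have "g 1 \<in> vspan V B" using B car by (auto simp: vbasis_def)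
    then have "\<not> B \<subseteq> {g 0}" using span0[of B] inj[of 1 0] by auto
    then obtain x where x: "x \<in> B" "x \<noteq> g 0" by blast
    then obtain a where "x = g a" using B car by (auto simp: vbasis_def)
    then have a: "g a \<in> B" "a \<noteq> 0" using x by auto
    have "B = {g a}"
    proof (rule ccontr)
      assume "B \<noteq> {g a}"
      then obtain b where b: "b \<in> B" "b \<noteq> g a" using a by blast
      then have "vspan V (B - {b}) = vcarrier V"
        using a B by (intro span[of _ a]) (auto simp: vbasis_def)
      then show False using B b by (auto simp: vbasis_def)
    qed
    then show ?thesis by simp
  qed
  have B1: "vbasis V {g 1}"
    using span[of "{g 1}" 1] span0[of "{}"] inj[of 1 0] car by (auto simp: vbasis_def)
  then show "vfinite_dim V" by (auto simp: vfinite_dim_def)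
  show "vdim V = 1" unfolding vdim_def using someI[of "vbasis V", OF B1] by (rule card)
qed

section \<open>Complex multiples and rank one operators\<close>

definition cmul :: "complex \<Rightarrow> ('a::chilbert \<Rightarrow>\<^sub>L 'a) \<Rightarrow> 'a \<Rightarrow>\<^sub>L 'a" where
  "cmul c A = Blinfun (\<lambda>x. c *\<^sub>C A x)"

lemma cmul_apply [simp]: "blinfun_apply (cmul c A) x = c *\<^sub>C A x"
  unfolding cmul_def
  by (simp add: bounded_linear_Blinfun_apply bounded_linear_compose[OF bounded_linear_scaleC_right blinfun.bounded_linear_right])

text \<open>The operators form a real normed space, so continuity in a complex scalar is reduced to
  real scalar multiplication by its real and imaginary parts.\<close>

lemma cmul_Re_Im: "cmul c A = Re c *\<^sub>R A + Im c *\<^sub>R cmul \<i> A"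
proof (rule blinfun_eqI)
  fix x
  have "c = complex_of_real (Re c) + complex_of_real (Im c) * \<i>" by (simp add: complex_eq mult.commute)
  then have "c *\<^sub>C A x = complex_of_real (Re c) *\<^sub>C A x + (complex_of_real (Im c) * \<i>) *\<^sub>C A x"
    by (metis scaleC_add_left)
  then show "cmul c A x = (Re c *\<^sub>R A + Im c *\<^sub>R cmul \<i> A) x"
    by (simp add: blinfun.add_left blinfun.scaleR_left scaleR_scaleC scaleC_scaleC)
qed

lemma continuous_on_cmul [continuous_intros]:
  "continuous_on S f \<Longrightarrow> continuous_on S (\<lambda>x. cmul (f x) A)"
proof -
  assume f: "continuous_on S f"
  have eq: "(\<lambda>x. cmul (f x) A) = (\<lambda>x. Re (f x) *\<^sub>R A + Im (f x) *\<^sub>R cmul \<i> A)"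
    by (rule ext) (rule cmul_Re_Im)
  show ?thesis unfolding eq using f by (intro continuous_intros)
qed

lemma cbounded_scaleC: "A \<in> cbounded \<Longrightarrow> blinfun_apply A (c *\<^sub>C x) = c *\<^sub>C A x"
  by (simp add: cbounded_def)

lemma cbounded_intros:
  "id_blinfun \<in> cbounded"
  "A \<in> cbounded \<Longrightarrow> B \<in> cbounded \<Longrightarrow> A + B \<in> cbounded"
  "A \<in> cbounded \<Longrightarrow> B \<in> cbounded \<Longrightarrow> A o\<^sub>L B \<in> cbounded"
  "A \<in> cbounded \<Longrightarrow> cmul c A \<in> cbounded"
  by (simp_all add: cbounded_def blinfun.add_left scaleC_add_right scaleC_scaleC mult.commute)

lemma Transfer_cbounded: "orthonormal J a \<Longrightarrow> orthonormal J b \<Longrightarrow> Transfer J a b \<in> cbounded"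
  by (simp add: cbounded_def Transfer_scaleC)

definition rank1 :: "'a::chilbert \<Rightarrow> 'a \<Rightarrow>\<^sub>L 'a" where
  "rank1 u = Blinfun (\<lambda>x. cinner u x *\<^sub>C u)"

lemma rank1_apply [simp]: "blinfun_apply (rank1 u) x = cinner u x *\<^sub>C u"
  unfolding rank1_def
  using bounded_linear_compose[OF bounded_bilinear.bounded_linear_left[OF bounded_bilinear_scaleC]
      bounded_linear_cinner, of u u]
  by (simp add: bounded_linear_Blinfun_apply)

lemma rank1_cbounded: "rank1 u \<in> cbounded"
  by (simp add: cbounded_def cinner_scaleC_right scaleC_scaleC)

text \<open>Puts GL(H) into the chart at 0: the kernel is zero and the cokernel consists of the
  single coset \<open>UNIV\<close>, so the index vanishes.\<close>

lemma invertible_in_quillen_U: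
  assumes T: "T \<in> cbounded" "op_invertible T"
  shows "T \<in> quillen_U 0"
proof -
  obtain S where S: "S o\<^sub>L T = id_blinfun" "T o\<^sub>L S = id_blinfun"
    using T by (auto simp: op_invertible_def)
  have ST: "S (T x) = x" "T (S x) = x" for x
    using S by (simp_all flip: blinfun_apply_blinfun_compose)
  have ker: "T x = 0 \<longleftrightarrow> x = 0" for x
    by (metis ST(1) blinfun.zero_right)
  have ran: "range T = UNIV" by (rule surjI[of T S]) (rule ST(2))
  have K: "vcarrier (Ker T) = {0}" "vadd (Ker T) 0 0 = 0" "vscale (Ker T) c 0 = 0" for c
    by (simp_all add: Ker_def hspace_def ker)
  have cos: "vcoset hspace UNIV x = UNIV" for x :: 'a
  proof -
    have "\<exists>n. y = x + n" for y by (rule exI[of _ "y - x"]) simp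
    then show ?thesis unfolding vcoset_def by (simp add: hspace_def)
  qed
  have "\<exists>x z. y = x + z" "\<exists>x z. y = c *\<^sub>C x + z" for c and y :: 'a
    by (intro exI[of _ 0] exI[of _ y], simp)+
  then have addU: "{x + y |x y. x \<in> UNIV \<and> y \<in> UNIV} = (UNIV::'a set)"
    and scU: "{c *\<^sub>C x + n |x n. x \<in> UNIV \<and> n \<in> UNIV} = (UNIV::'a set)" for c
    by auto
  have C: "vcarrier (Coker T) = {UNIV}" "vadd (Coker T) UNIV UNIV = UNIV" "vscale (Coker T) c UNIV = UNIV" for c
    unfolding Coker_def vquot_def ran cos[THEN ext] using addU scU by (simp_all add: hspace_def)
  have "T \<in> Fredholm0"
    unfolding Fredholm0_def fredholm_def fredholm_index_def mem_Collect_eq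
      vdim_singleton(2)[OF K] vdim_singleton(2)[OF C]
    using vdim_singleton(1)[OF K] vdim_singleton(1)[OF C] T(1) by simp
  then show ?thesis unfolding quillen_U_def using T(2) by simp
qed

lemma quillen_U_0_I:
  assumes "T \<in> cbounded" "S \<in> cbounded" "S o\<^sub>L T = id_blinfun" "T o\<^sub>L S = id_blinfun"
  shows "T \<in> quillen_U 0"
  using assms(1) by (rule invertible_in_quillen_U) (use assms in \<open>unfold op_invertible_def, blast\<close>)

lemma quillen_U_0_compose:
  assumes "S \<in> quillen_U 0" "T \<in> quillen_U 0"
  shows "S o\<^sub>L T \<in> quillen_U 0"
proof (rule invertible_in_quillen_U)
  have "S \<in> cbounded" "T \<in> cbounded" "op_invertible S" "op_invertible T"
    using assms by (auto simp: quillen_U_def Fredholm0_def fredholm_def)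
  then obtain S' T' where *: "S' \<in> cbounded" "T' \<in> cbounded" and S': "S' o\<^sub>L S = id_blinfun" "S o\<^sub>L S' = id_blinfun"
    and T': "T' o\<^sub>L T = id_blinfun" "T o\<^sub>L T' = id_blinfun"
    unfolding op_invertible_def by (elim bexE conjE) (rule that)
  have **: "S' (S x) = x" "S (S' x) = x" "T' (T x) = x" "T (T' x) = x" for x
    using S' T' by (simp_all flip: blinfun_apply_blinfun_compose)
  show "S o\<^sub>L T \<in> cbounded" using \<open>S \<in> cbounded\<close> \<open>T \<in> cbounded\<close> by (rule cbounded_intros)
  have "T' o\<^sub>L S' \<in> cbounded" using * by (intro cbounded_intros)
  moreover have "(T' o\<^sub>L S') o\<^sub>L (S o\<^sub>L T) = id_blinfun" "(S o\<^sub>L T) o\<^sub>L (T' o\<^sub>L S') = id_blinfun"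
    by (rule blinfun_eqI, simp add: **)+
  ultimately show "op_invertible (S o\<^sub>L T)" unfolding op_invertible_def by blast
qed

text \<open>The operator T_w of the overview when \<open>u\<close> is a unit vector: multiplication
  by \<open>w\<close> on the line of \<open>u\<close>, the identity on its orthogonal
  complement.\<close>

definition dilation :: "'a::chilbert \<Rightarrow> complex \<Rightarrow> 'a \<Rightarrow>\<^sub>L 'a" where
  "dilation u w = id_blinfun + cmul (w - 1) (rank1 u)"

lemma dilation_apply: "dilation u w x = x + ((w - 1) * cinner u x) *\<^sub>C u"
  by (simp add: dilation_def blinfun.add_left scaleC_scaleC)

lemma dilation_cbounded: "dilation u w \<in> cbounded"
  unfolding dilation_def by (intro cbounded_intros rank1_cbounded)

lemma dilation_compose:
  assumes "cinner u u = 1"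
  shows "dilation u v o\<^sub>L dilation u w = dilation u (v * w)"
proof (rule blinfun_eqI)
  fix x
  have "dilation u v (dilation u w x) =
      x + ((w - 1) * cinner u x + (v - 1) * (cinner u x + (w - 1) * cinner u x)) *\<^sub>C u"
    using assms by (simp add: dilation_apply cinner_add_right cinner_scaleC_right scaleC_add_left)
  also have "(w - 1) * cinner u x + (v - 1) * (cinner u x + (w - 1) * cinner u x) = (v * w - 1) * cinner u x"
    by (simp add: algebra_simps)
  finally show "(dilation u v o\<^sub>L dilation u w) x = dilation u (v * w) x"
    by (simp add: dilation_apply)
qed

lemma dilation_1: "dilation u 1 = id_blinfun"
  by (rule blinfun_eqI) (simp add: dilation_apply)

lemma dilation_in_quillen_U_0:
  assumes "cinner u u = 1" "w \<noteq> 0"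
  shows "dilation u w \<in> quillen_U 0"
  by (rule quillen_U_0_I[of _ "dilation u (1 / w)"])
    (use assms in \<open>simp_all add: dilation_cbounded dilation_compose dilation_1\<close>)

text \<open>The only singular member of the family. Its kernel and its cokernel are both lines, so
  it still has index zero.\<close>

lemma dilation_0_Fredholm0:
  assumes u: "cinner u u = 1"
  shows "dilation u 0 \<in> Fredholm0"
proof -
  let ?T = "dilation u 0"
  have T: "?T x = x - cinner u x *\<^sub>C u" for x
    by (simp add: dilation_apply scaleC_minus_left)
  have u0: "u \<noteq> 0" using u by auto
  have inj: "a *\<^sub>C u = b *\<^sub>C u \<longleftrightarrow> a = b" for a b
    using scaleC_eq_0_iff[of "a - b" u] u0 by (auto simp: scaleC_diff_left)
  have "vcarrier (Ker ?T) = range (\<lambda>c. c *\<^sub>C u)"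
    by (auto simp: Ker_def T cinner_scaleC_right u image_iff)
  then have K: "bij_betw (\<lambda>c. c *\<^sub>C u) UNIV (vcarrier (Ker ?T))"
    by (auto simp: bij_betw_def inj_on_def inj)
  have K': "vadd (Ker ?T) (a *\<^sub>C u) (b *\<^sub>C u) = (a + b) *\<^sub>C u"
     "vscale (Ker ?T) a (b *\<^sub>C u) = (a * b) *\<^sub>C u" for a b
    by (auto simp: Ker_def hspace_def scaleC_add_left scaleC_scaleC)
  \<comment> \<open>The range is the orthogonal complement of \<open>u\<close>, so its cosets are
    the level sets of \<open>cinner u\<close>; this is the coordinate on the cokernel.\<close>
  let ?g = "\<lambda>c. {y. cinner u y = c}"
  have ran: "range ?T = {y. cinner u y = 0}"
  proof (intro equalityI subsetI)
    fix y assume "y \<in> {y. cinner u y = 0}"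
    then have "?T y = y" by (simp add: T)
    then show "y \<in> range ?T" by (metis rangeI)
  qed (auto simp: T cinner_diff_right cinner_scaleC_right u)
  have cos: "vcoset hspace (range ?T) x = ?g (cinner u x)" for x
  proof (intro equalityI subsetI)
    fix y assume "y \<in> ?g (cinner u x)"
    then have "y = x + (y - x)" "cinner u (y - x) = 0" by (auto simp: cinner_diff_right)
    then show "y \<in> vcoset hspace (range ?T) x" unfolding vcoset_def ran
      by (auto simp: hspace_def intro!: exI[of _ "y - x"])
  qed (auto simp: vcoset_def ran hspace_def cinner_add_right)
  have gu: "cinner u (c *\<^sub>C u) = c" for c by (simp add: cinner_scaleC_right u)
  have "vcarrier (Coker ?T) = range (\<lambda>x. ?g (cinner u x))"
    unfolding Coker_def vquot_def cos[THEN ext] by (simp add: hspace_def)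
  also have "\<dots> = range ?g" by (auto simp: image_iff) (metis gu)
  finally have "vcarrier (Coker ?T) = range ?g" .
  moreover have "inj ?g"
  proof (rule injI)
    fix a b assume "?g a = ?g b"
    moreover have "a *\<^sub>C u \<in> ?g a" by (simp add: gu)
    ultimately show "a = b" by (simp add: gu)
  qed
  ultimately have C: "bij_betw ?g UNIV (vcarrier (Coker ?T))" by (simp add: bij_betw_def)
  have C1: "vadd (Coker ?T) (?g a) (?g b) = ?g (a + b)" for a b
  proof -
    have "vadd (Coker ?T) (?g a) (?g b) = {x + y |x y. cinner u x = a \<and> cinner u y = b}"
      by (simp add: Coker_def vquot_def hspace_def)
    also have "\<dots> = ?g (a + b)"
    proof (intro equalityI subsetI)
      fix z assume "z \<in> ?g (a + b)"
      then have "z = (z - b *\<^sub>C u) + b *\<^sub>C u \<and> cinner u (z - b *\<^sub>C u) = a \<and> cinner u (b *\<^sub>C u) = b"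
        by (simp add: cinner_diff_right gu)
      then show "z \<in> {x + y |x y. cinner u x = a \<and> cinner u y = b}" by blast
    qed (auto simp: cinner_add_right)
    finally show ?thesis .
  qed
  have C2: "vscale (Coker ?T) c (?g a) = ?g (c * a)" for c a
  proof -
    have "vscale (Coker ?T) c (?g a) = {c *\<^sub>C x + n |x n. cinner u x = a \<and> cinner u n = 0}"
      by (simp add: Coker_def vquot_def ran hspace_def)
    also have "\<dots> = ?g (c * a)"
    proof (intro equalityI subsetI)
      fix z assume "z \<in> ?g (c * a)"
      then have "z = c *\<^sub>C (a *\<^sub>C u) + (z - c *\<^sub>C (a *\<^sub>C u)) \<and> cinner u (a *\<^sub>C u) = a \<and>
          cinner u (z - c *\<^sub>C (a *\<^sub>C u)) = 0"
        by (simp add: cinner_diff_right cinner_scaleC_right[of _ c] gu)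
      then show "z \<in> {c *\<^sub>C x + n |x n. cinner u x = a \<and> cinner u n = 0}" by blast
    qed (auto simp: cinner_add_right cinner_scaleC_right)
    finally show ?thesis .
  qed
  show ?thesis
    using vdim_line[OF K K'] vdim_line[OF C C1 C2] dilation_cbounded
    by (simp add: Fredholm0_def fredholm_def fredholm_index_def)
qed

lemma dilation_Fredholm0: "cinner u u = 1 \<Longrightarrow> dilation u w \<in> Fredholm0"
  using dilation_in_quillen_U_0[of u w] dilation_0_Fredholm0[of u] by (cases "w = 0") (auto simp: quillen_U_def)

text \<open>For \<open>a \<ge> 0\<close> the operator is positive and hence its own absolute value,
  and along a basis through \<open>u\<close> its trace has at most one nonzero term. The cases
  \<open>a = 2\<close> and \<open>a = 0\<close> give the two charts of the proof.\<close>

lemma rank1_trace_class: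
  fixes u :: "'a::chilbert"
  assumes E: "orthonormal_basis E" "u \<in> E" and a: "a \<ge> 0"
  shows "cmul (complex_of_real a) (rank1 u) \<in> trace_class"
proof -
  let ?K = "cmul (complex_of_real a) (rank1 u)"
  have u: "cinner u u = 1" using E by (simp add: orthonormal_basis_def)
  have K: "?K \<in> cbounded" by (intro cbounded_intros rank1_cbounded)
  have "cinner x (?K x) = complex_of_real (a * (cmod (cinner u x))\<^sup>2)" for x
  proof -
    have "cinner x (?K x) = complex_of_real a * (cinner u x * cinner x u)"
      by (simp add: cinner_scaleC_right mult.assoc)
    also have "cinner u x * cinner x u = complex_of_real ((cmod (cinner u x))\<^sup>2)"
      using complex_norm_square[of "cinner u x"] cinner_commute[of x u] by simp
    finally show ?thesis by simp
  qed
  then have "positive_op ?K" using K a unfolding positive_op_def by simp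
  moreover have "cinner x (?K (?K y)) = cinner (?K x) (?K y)" for x y
    using u cinner_commute[of x u] by (simp add: cinner_scaleC_right cinner_scaleC_left)
  ultimately have "is_abs_op ?K ?K" by (simp add: is_abs_op_def)
  moreover have "(\<lambda>e. Re (cinner e (?K e))) summable_on E"
  proof -
    have "Re (cinner e (?K e)) = 0" if "e \<in> E - {u}" for e
      using E that by (simp add: orthonormal_basis_def cinner_scaleC_right)
    then have "((\<lambda>e. Re (cinner e (?K e))) has_sum (\<Sum>e\<in>{u}. Re (cinner e (?K e)))) E"
      using E(2) by (intro has_sum_finite_neutralI[of "{u}"]) simp_all
    then show ?thesis by (rule has_sum_imp_summable)
  qed
  ultimately show ?thesis using K E unfolding trace_class_def by blast
qed

text \<open>The perturbation has \<open>c\<close> as its only nonzero eigenvalue, with the line of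
  \<open>u\<close> as generalized eigenspace, so the product has a single factor.\<close>

lemma det_F_rank1:
  fixes u :: "'a::chilbert"
  assumes u: "cinner u u = 1" and c: "c \<noteq> 0"
  shows "det_F (\<lambda>x. x + (c * cinner u x) *\<^sub>C u) = 1 + c"
proof -
  define K where "K = (\<lambda>x. (c * cinner u x) *\<^sub>C u)"
  have u0: "u \<noteq> 0" using u by auto
  have inj: "a *\<^sub>C u = b *\<^sub>C u \<longleftrightarrow> a = b" for a b
    using scaleC_eq_0_iff[of "a - b" u] u0 by (auto simp: scaleC_diff_left)
  have ev: "eigenvalues K - {0} = {c}"
  proof (intro equalityI subsetI)
    fix l assume "l \<in> eigenvalues K - {0}"
    then obtain x where x: "x \<noteq> 0" "(c * cinner u x) *\<^sub>C u = l *\<^sub>C x" "l \<noteq> 0"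
      by (auto simp: eigenvalues_def K_def)
    have "cinner u ((c * cinner u x) *\<^sub>C u) = cinner u (l *\<^sub>C x)" by (simp only: x(2))
    then have "c * cinner u x = l * cinner u x" by (simp add: cinner_scaleC_right u)
    moreover have "cinner u x \<noteq> 0" using x by auto
    ultimately show "l \<in> {c}" by simp
  next
    fix l assume "l \<in> {c}"
    then show "l \<in> eigenvalues K - {0}" using c u u0
      by (auto simp: eigenvalues_def K_def intro!: exI[of _ u])
  qed
  define M where "M = (\<lambda>y. K y - c *\<^sub>C y)"
  \<comment> \<open>\<open>Q\<close> kills the line of \<open>u\<close>, which contains all values
    of \<open>K\<close>, and therefore turns \<open>M\<close> into multiplication by
    \<open>- c\<close>. As \<open>c\<close> is nonzero, a power of \<open>M\<close> can annihilate
    only vectors of that line.\<close>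
  define Q where "Q = (\<lambda>x. x - cinner u x *\<^sub>C u)"
  have QM: "Q (M y) = - c *\<^sub>C Q y" for y
    by (simp add: Q_def M_def K_def u cinner_diff_right cinner_scaleC_right scaleC_diff_right
        scaleC_diff_left scaleC_scaleC scaleC_minus_left algebra_simps)
  have QMn: "Q ((M ^^ n) x) = (- c) ^ n *\<^sub>C Q x" for n x
    by (induction n) (simp_all add: QM scaleC_scaleC)
  have "{x. \<exists>n. (M ^^ n) x = 0} = range (\<lambda>a. a *\<^sub>C u)"
  proof (intro equalityI subsetI)
    fix x assume "x \<in> {x. \<exists>n. (M ^^ n) x = 0}"
    then obtain n where "(M ^^ n) x = 0" by blast
    then have "(- c) ^ n *\<^sub>C Q x = 0" using QMn[of n x] by (simp add: Q_def)
    then have "Q x = 0" using c by simp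
    then show "x \<in> range (\<lambda>a. a *\<^sub>C u)" by (auto simp: Q_def)
  next
    fix x assume "x \<in> range (\<lambda>a. a *\<^sub>C u)"
    then have "(M ^^ 1) x = 0" by (auto simp: M_def K_def cinner_scaleC_right u scaleC_scaleC)
    then show "x \<in> {x. \<exists>n. (M ^^ n) x = 0}" by blast
  qed
  then have "bij_betw (\<lambda>a. a *\<^sub>C u) UNIV (vcarrier (hspace\<lparr>vcarrier := {x. \<exists>n. (M ^^ n) x = 0}\<rparr>))"
    by (auto simp: bij_betw_def inj_on_def inj)
  then have "vdim (hspace\<lparr>vcarrier := {x. \<exists>n. (M ^^ n) x = 0}\<rparr>) = 1"
    by (rule vdim_line(2)) (simp_all add: hspace_def scaleC_add_left scaleC_scaleC)
  then have mult: "alg_mult K c = 1" by (simp add: alg_mult_def M_def)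
  have "det_F (\<lambda>x. x + (c * cinner u x) *\<^sub>C u) =
      Lim (finite_subsets_at_top {c}) (\<lambda>F. \<Prod>l\<in>F. (1 + l) ^ alg_mult K l)"
    unfolding det_F_def Let_def using ev by (simp add: K_def)
  \<comment> \<open>Over a finite index set the filter is principal, concentrated at the whole set,
    so the limit is the plain product.\<close>
  also have "\<dots> = (\<Prod>l\<in>{c}. (1 + l) ^ alg_mult K l)"
    by (rule tendsto_Lim) (auto simp: finite_subsets_at_top_finite principal_eq_bot_iff eventually_principal
        intro!: tendsto_eventually)
  finally show ?thesis by (simp add: mult)
qed

section \<open>Contracting a loop of invertible operators\<close>

text \<open>Two orthonormal families spanning orthogonal subspaces make the 2 by 2 matrices act on
  \<open>H\<close>, by the identity on the orthogonal complement.\<close>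

definition matrix_op :: "(nat \<Rightarrow> 'a) \<Rightarrow> (nat \<Rightarrow> 'a) \<Rightarrow> complex \<Rightarrow> complex \<Rightarrow> complex \<Rightarrow> complex
    \<Rightarrow> 'a::chilbert \<Rightarrow>\<^sub>L 'a" where
  "matrix_op a b p q r s = id_blinfun + cmul (p - 1) (Transfer UNIV a a) + cmul q (Transfer UNIV b a)
     + cmul r (Transfer UNIV a b) + cmul (s - 1) (Transfer UNIV b b)"

locale orthogonal_families =
  fixes a b :: "nat \<Rightarrow> 'a::chilbert"
  assumes a: "orthonormal UNIV a" and b: "orthonormal UNIV b"
    and ab: "cinner (a i) (b j) = 0"
begin

lemma ba: "cinner (b i) (a j) = 0"
  using ab[of j i] cinner_commute[of "b i" "a j"] by simp

text \<open>The multiplication table of the four matrix units: a product survives exactly when its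
  inner indices agree. It is stated on vectors so that rewriting can work inside sums.\<close>

lemma transfer_rules:
  "Transfer UNIV a a (Transfer UNIV a a x) = Transfer UNIV a a x"
  "Transfer UNIV a b (Transfer UNIV a a x) = Transfer UNIV a b x"
  "Transfer UNIV a a (Transfer UNIV b a x) = Transfer UNIV b a x"
  "Transfer UNIV a b (Transfer UNIV b a x) = Transfer UNIV b b x"
  "Transfer UNIV b b (Transfer UNIV b b x) = Transfer UNIV b b x"
  "Transfer UNIV b a (Transfer UNIV b b x) = Transfer UNIV b a x"
  "Transfer UNIV b b (Transfer UNIV a b x) = Transfer UNIV a b x"
  "Transfer UNIV b a (Transfer UNIV a b x) = Transfer UNIV a a x"
  "Transfer UNIV a a (Transfer UNIV b b x) = 0"
  "Transfer UNIV a b (Transfer UNIV b b x) = 0"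
  "Transfer UNIV a a (Transfer UNIV a b x) = 0"
  "Transfer UNIV a b (Transfer UNIV a b x) = 0"
  "Transfer UNIV b b (Transfer UNIV a a x) = 0"
  "Transfer UNIV b a (Transfer UNIV a a x) = 0"
  "Transfer UNIV b b (Transfer UNIV b a x) = 0"
  "Transfer UNIV b a (Transfer UNIV b a x) = 0"
  unfolding blinfun_apply_blinfun_compose[symmetric]
  using Transfer_compose[OF a a a] Transfer_compose[OF a a b] Transfer_compose[OF b a a]
    Transfer_compose[OF b a b] Transfer_compose[OF b b b] Transfer_compose[OF b b a]
    Transfer_compose[OF a b b] Transfer_compose[OF a b a]
    Transfer_compose_orthogonal[OF b b a a ab] Transfer_compose_orthogonal[OF b b a b ab]
    Transfer_compose_orthogonal[OF a b a a ab] Transfer_compose_orthogonal[OF a b a b ab]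
    Transfer_compose_orthogonal[OF a a b b ba] Transfer_compose_orthogonal[OF a a b a ba]
    Transfer_compose_orthogonal[OF b a b b ba] Transfer_compose_orthogonal[OF b a b a ba]
  by simp_all

lemma matrix_op_apply:
  "matrix_op a b p q r s x = x + (p - 1) *\<^sub>C Transfer UNIV a a x + q *\<^sub>C Transfer UNIV b a x
     + r *\<^sub>C Transfer UNIV a b x + (s - 1) *\<^sub>C Transfer UNIV b b x"
  by (simp add: matrix_op_def blinfun.add_left)

lemma matrix_op_cbounded: "matrix_op a b p q r s \<in> cbounded"
  unfolding matrix_op_def by (intro cbounded_intros Transfer_cbounded a b)

lemma matrix_op_id: "matrix_op a b 1 0 0 1 = id_blinfun"
  by (rule blinfun_eqI) (simp add: matrix_op_apply)

lemma matrix_op_compose: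
  "matrix_op a b p q r s o\<^sub>L matrix_op a b p' q' r' s' =
   matrix_op a b (p * p' + q * r') (p * q' + q * s') (r * p' + s * r') (r * q' + s * s')"
proof (rule blinfun_eqI)
  fix x
  show "blinfun_apply (matrix_op a b p q r s o\<^sub>L matrix_op a b p' q' r' s') x =
   matrix_op a b (p * p' + q * r') (p * q' + q * s') (r * p' + s * r') (r * q' + s * s') x"
    by (simp add: matrix_op_apply blinfun.add_right Transfer_scaleC a b transfer_rules
        blinfun.diff_right scaleC_diff_right scaleC_add_right scaleC_scaleC scaleC_add_left scaleC_diff_left algebra_simps)
qed

text \<open>Cramer's rule: the adjugate divided by the determinant represents a bounded
  inverse.\<close>

lemma matrix_op_quillen_U_0:
  assumes "p * s - q * r \<noteq> 0"
  shows "matrix_op a b p q r s \<in> quillen_U 0"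
proof -
  define d where "d = p * s - q * r"
  have "d \<noteq> 0" using assms by (simp add: d_def)
  then have "p * (s / d) + q * (- r / d) = 1" "p * (- q / d) + q * (p / d) = 0"
    "r * (s / d) + s * (- r / d) = 0" "r * (- q / d) + s * (p / d) = 1"
    "(s / d) * p + (- q / d) * r = 1" "(s / d) * q + (- q / d) * s = 0"
    "(- r / d) * p + (p / d) * r = 0" "(- r / d) * q + (p / d) * s = 1"
    by (simp_all add: divide_simps) (simp_all add: d_def algebra_simps)
  then show ?thesis
    by (intro quillen_U_0_I[of _ "matrix_op a b (s / d) (- q / d) (- r / d) (p / d)"])
      (simp_all only: matrix_op_cbounded matrix_op_compose matrix_op_id)
qed

text \<open>The rotation by \<open>t\<close>, conjugated by \<open>diag(w, 1)\<close> and followed by the inverse rotation.\<close>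

definition rotation_homotopy :: "real \<times> complex \<Rightarrow> 'a \<Rightarrow>\<^sub>L 'a" where
  "rotation_homotopy = (\<lambda>(t, w). let c = complex_of_real (cos (t * pi / 2)); s = complex_of_real (sin (t * pi / 2)) in
     matrix_op a b (c\<^sup>2 + s\<^sup>2 * w) (c * s * (1 - w)) (c * s * (1 / w - 1)) (c\<^sup>2 + s\<^sup>2 / w))"

lemma rotation_homotopy_0: "rotation_homotopy (0, w) = id_blinfun"
  by (simp add: rotation_homotopy_def matrix_op_id)

lemma rotation_homotopy_1: "rotation_homotopy (1, w) = matrix_op a b w 0 0 (1 / w)"
  by (simp add: rotation_homotopy_def)

text \<open>The matrix is a commutator of \<open>diag(w, 1)\<close> and a rotation, so its
  determinant is 1 for every \<open>t\<close>.\<close>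

lemma rotation_homotopy_quillen_U_0:
  assumes "w \<noteq> 0"
  shows "rotation_homotopy (t, w) \<in> quillen_U 0"
proof -
  define c s where "c = complex_of_real (cos (t * pi / 2))" and "s = complex_of_real (sin (t * pi / 2))"
  have cs: "c\<^sup>2 + s\<^sup>2 = 1"
    unfolding c_def s_def of_real_power[symmetric] of_real_add[symmetric] by (simp add: add.commute)
  have "(c\<^sup>2 + s\<^sup>2 * w) * (c\<^sup>2 + s\<^sup>2 / w) - (c * s * (1 - w)) * (c * s * (1 / w - 1)) = (c\<^sup>2 + s\<^sup>2)\<^sup>2"
    using assms by (simp add: field_simps power2_eq_square)
  also have "\<dots> \<noteq> 0" by (simp add: cs)
  finally have "matrix_op a b (c\<^sup>2 + s\<^sup>2 * w) (c * s * (1 - w)) (c * s * (1 / w - 1)) (c\<^sup>2 + s\<^sup>2 / w) \<in> quillen_U 0"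
    by (rule matrix_op_quillen_U_0)
  then show ?thesis by (simp add: rotation_homotopy_def Let_def c_def s_def)
qed

lemma continuous_rotation_homotopy:
  assumes "0 \<notin> W"
  shows "continuous_on (S \<times> W) rotation_homotopy"
  using assms unfolding rotation_homotopy_def matrix_op_def Let_def case_prod_unfold
  by (intro continuous_intros) auto

end

text \<open>Prepares the shift by one in the swindle, where the second factor acts on all terms of
  the sequence except \<open>a 0\<close>.\<close>

lemma Transfer_UNIV_split:
  assumes a: "orthonormal UNIV (a :: nat \<Rightarrow> 'a::chilbert)"
  shows "Transfer UNIV a a = rank1 (a 0) + Transfer UNIV (a \<circ> Suc) (a \<circ> Suc)"
proof (rule blinfun_eqI)
  fix x
  let ?f = "\<lambda>i. cinner (a i) x *\<^sub>C a i"
  have S: "orthonormal UNIV (a \<circ> Suc)" using a by (simp add: orthonormal_def)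
  have "((?f \<circ> Suc) has_sum Transfer UNIV (a \<circ> Suc) (a \<circ> Suc) x) UNIV"
    using has_sum_transfer[OF S S, of x] by (simp add: o_def)
  then have "(?f has_sum Transfer UNIV (a \<circ> Suc) (a \<circ> Suc) x) (range Suc)"
    by (subst has_sum_reindex) auto
  then have "(?f has_sum (?f 0 + Transfer UNIV (a \<circ> Suc) (a \<circ> Suc) x)) (insert 0 (range Suc))"
    by (intro has_sum_insert) auto
  then have "(?f has_sum (?f 0 + Transfer UNIV (a \<circ> Suc) (a \<circ> Suc) x)) UNIV"
    by (simp flip: UNIV_nat_eq)
  then show "Transfer UNIV a a x = (rank1 (a 0) + Transfer UNIV (a \<circ> Suc) (a \<circ> Suc)) x"
    using has_sum_unique[OF has_sum_transfer[OF a a]] by (simp add: blinfun.add_left)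
qed

text \<open>An Eilenberg swindle: with respect to an orthonormal sequence,
  \<open>diag(w, 1, 1, \<dots>) = diag(w, 1/w, w, 1/w, \<dots>) diag(1, w, 1/w, w, \<dots>)\<close>, and both factors contract
  blockwise.\<close>

lemma dilation_swindle:
  assumes ab: "orthogonal_families a b" and ba: "orthogonal_families b (a \<circ> Suc)" and w: "w \<noteq> 0"
  shows "matrix_op a b w 0 0 (1 / w) o\<^sub>L matrix_op b (a \<circ> Suc) w 0 0 (1 / w) = dilation (a 0) w"
proof (rule blinfun_eqI)
  fix x
  interpret ab: orthogonal_families a b by fact
  interpret ba: orthogonal_families b "a \<circ> Suc" by fact
  define P where "P = Transfer UNIV (a \<circ> Suc) (a \<circ> Suc)"
  define Q where "Q = Transfer UNIV b b"
  define R where "R = rank1 (a 0)"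
  \<comment> \<open>The deviations of \<open>w\<close> and \<open>1 / w\<close> from 1. Since (1 +
    v)(1 + v') = 1, the coefficients of \<open>P\<close> and \<open>Q\<close> in the product vanish,
    and only \<open>v\<close> on the line of \<open>a 0\<close> survives.\<close>
  define v v' where "v = w - 1" and "v' = 1 / w - 1"
  have PP: "P (P y) = P y" and PQ: "P (Q y) = 0" and QP: "Q (P y) = 0" and QQ: "Q (Q y) = Q y" for y
    unfolding P_def Q_def by (rule ba.transfer_rules)+
  have A: "Transfer UNIV a a y = R y + P y" for y
    unfolding R_def P_def Transfer_UNIV_split[OF ab.a] by (simp add: blinfun.add_left)
  have "R (P y) = 0" for y
  proof -
    have "cinner (a 0) (P y) = 0"
      unfolding P_def
      by (rule has_sum_cinner_orthogonal[OF has_sum_transfer[OF ba.b ba.b]])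
        (use ab.a in \<open>simp add: orthonormal_def\<close>)
    then show ?thesis by (simp add: R_def)
  qed
  moreover have "R (Q y) = 0" for y
    using ab.transfer_rules(9)[of y] PQ[of y] A[of "Q y"] by (simp add: Q_def)
  moreover have sc: "P (c *\<^sub>C y) = c *\<^sub>C P y" "Q (c *\<^sub>C y) = c *\<^sub>C Q y" "R (c *\<^sub>C y) = c *\<^sub>C R y" for c y
    unfolding P_def Q_def R_def
    by (simp_all only: Transfer_scaleC ab.b ba.b cbounded_scaleC[OF rank1_cbounded])
  ultimately have "(matrix_op a b w 0 0 (1 / w) o\<^sub>L matrix_op b (a \<circ> Suc) w 0 0 (1 / w)) x
      = x + v *\<^sub>C R x + (v' + v + v * v') *\<^sub>C P x + (v + v' + v' * v) *\<^sub>C Q x"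
    by (simp add: ab.matrix_op_apply ba.matrix_op_apply A PP PQ QP QQ blinfun.add_right
        scaleC_add_right scaleC_scaleC scaleC_add_left flip: P_def Q_def v_def v'_def)
  moreover have "v' + v + v * v' = 0" "v + v' + v' * v = 0"
    unfolding v_def v'_def
    using w by (simp_all add: field_simps)
  ultimately show "(matrix_op a b w 0 0 (1 / w) o\<^sub>L matrix_op b (a \<circ> Suc) w 0 0 (1 / w)) x = dilation (a 0) w x"
    by (simp add: dilation_def blinfun.add_left R_def v_def)
qed

text \<open>Both factors of the swindle are contracted with the same parameter. Products of
  invertible operators are invertible, so the homotopy stays in GL(H).\<close>

lemma dilation_loop_null_homotopic:
  fixes e :: "nat \<Rightarrow> 'a::chilbert"
  assumes e: "orthonormal UNIV e" 
  obtains G where "continuous_on ({0..1} \<times> sphere 0 1) G" "G ` ({0..1} \<times> sphere 0 1) \<subseteq> quillen_U 0"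
    "\<And>w. G (0::real, w) = id_blinfun" "\<And>w. w \<in> sphere 0 1 \<Longrightarrow> G (1, w) = dilation (e 0) w"
proof -
  \<comment> \<open>One sequence is cut into consecutive pairs in two ways: (2i, 2i+1) for
    \<open>a\<close> and \<open>b\<close>, and (2i+1, 2i+2) for \<open>b\<close> and
    \<open>a \<circ> Suc\<close>. The offset makes each factor \<open>1 / w\<close> of one grouping
    meet a factor \<open>w\<close> of the other.\<close>
  define a b where "a i = e (2 * i)" and "b i = e (Suc (2 * i))" for i
  interpret ab: orthogonal_families a b
    by unfold_locales (use e in \<open>auto simp: a_def b_def orthonormal_def, presburger\<close>)
  interpret ba: orthogonal_families b "a \<circ> Suc"
    by unfold_locales (use e in \<open>auto simp: a_def b_def orthonormal_def, presburger\<close>)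
  let ?G = "\<lambda>p. ab.rotation_homotopy p o\<^sub>L ba.rotation_homotopy p"
  show ?thesis
  proof (rule that[of ?G])
    show "continuous_on ({0..1} \<times> sphere 0 1) ?G"
      by (intro bounded_bilinear.continuous_on[OF bounded_bilinear_blinfun_compose]
          ab.continuous_rotation_homotopy ba.continuous_rotation_homotopy) auto
    have "?G (t, w) \<in> quillen_U 0" if "w \<in> sphere 0 1" for t w
    proof -
      have "w \<noteq> 0" using that by auto
      then show ?thesis
        by (intro quillen_U_0_compose ab.rotation_homotopy_quillen_U_0 ba.rotation_homotopy_quillen_U_0)
    qed
    then show "?G ` ({0..1} \<times> sphere 0 1) \<subseteq> quillen_U 0" by auto
    show "?G (0, w) = id_blinfun" for w
      by (rule blinfun_eqI) (simp add: ab.rotation_homotopy_0 ba.rotation_homotopy_0)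
    show "?G (1, w) = dilation (e 0) w" if "w \<in> sphere 0 1" for w
    proof -
      have "w \<noteq> 0" using that by auto
      then have "?G (1, w) = dilation (a 0) w"
        unfolding ab.rotation_homotopy_1 ba.rotation_homotopy_1
        by (rule dilation_swindle[OF ab.orthogonal_families_axioms ba.orthogonal_families_axioms])
      then show ?thesis by (simp add: a_def)
    qed
  qed
qed

section \<open>Trivializations of the determinant line bundle\<close>

lemma vspan_add:
  assumes "\<And>x y. vadd V x y = (\<lambda>t. x t + y t)"
  shows "x \<in> vspan V R \<Longrightarrow> y \<in> vspan V R \<Longrightarrow> (\<lambda>t. x t + y t) \<in> vspan V R"
  using assms unfolding vspan_def hull_def vsubspace_def by simp

lemma vspan_scale:
  assumes "\<And>c x. vscale V c x = (\<lambda>t. c * x t)"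
  shows "x \<in> vspan V R \<Longrightarrow> (\<lambda>t. c * x t) \<in> vspan V R"
  using assms unfolding vspan_def hull_def vsubspace_def by simp

lemma zero_in_vspan:
  assumes "\<And>c x. vscale V c x = (\<lambda>t. c * x t)"
  shows "(\<lambda>t. 0) \<in> vspan V R"
  unfolding vspan_def hull_def
proof (clarsimp)
  fix W assume W: "vsubspace V W" 
  then obtain x where "x \<in> W" by (auto simp: vsubspace_def)
  then have "vscale V 0 x \<in> W" using W by (auto simp: vsubspace_def)
  then show "(\<lambda>t. 0) \<in> W" using assms by simp
qed

text \<open>The relations of the outer tensor product; as a coset, this set is the zero vector of
  the fibre. Unfolding this outermost quotient is enough to compute with scalars.\<close>

definition fibre_null :: "('h::chilbert \<Rightarrow>\<^sub>L 'h) \<Rightarrow> 'h quillen_vec" where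
  "fibre_null T = tensor_null (ext_power (vdim (Ker T)) (vdual (Ker T)))
                            (ext_power (vdim (Coker T)) (Coker T))"

lemma fibre_scale:
  "vscale (quillen_fibre T) c X = {(\<lambda>t. c * x t + n t) |x n. x \<in> X \<and> n \<in> fibre_null T}"
  by (simp add: quillen_fibre_def tensor_def vquot_def fibre_null_def vfree_def)

lemma fibre_null:
  "(\<lambda>t. 0) \<in> fibre_null T"
  "x \<in> fibre_null T \<Longrightarrow> y \<in> fibre_null T \<Longrightarrow> (\<lambda>t. x t + y t) \<in> fibre_null T"
  "x \<in> fibre_null T \<Longrightarrow> (\<lambda>t. c * x t) \<in> fibre_null T"
  unfolding fibre_null_def
  by (auto intro!: zero_in_vspan vspan_add vspan_scale simp: vfree_def)

text \<open>Holds for an arbitrary set \<open>X\<close>, because scaling in \<open>vquot\<close>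
  adds the null space again each time; the inner null vectors are absorbed by the outer
  ones.\<close>

lemma fibre_scale_scale:
  fixes T :: "'h::chilbert \<Rightarrow>\<^sub>L 'h"
  shows "vscale (quillen_fibre T) c (vscale (quillen_fibre T) d X) = vscale (quillen_fibre T) (c * d) X"
proof (intro equalityI subsetI)
  fix z assume "z \<in> vscale (quillen_fibre T) c (vscale (quillen_fibre T) d X)"
  then obtain x n m where x: "x \<in> X" "n \<in> fibre_null T" "m \<in> fibre_null T"
    and z: "z = (\<lambda>t. c * (d * x t + n t) + m t)"
    unfolding fibre_scale by blast
  have "(\<lambda>t. c * n t + m t) \<in> fibre_null T"
    using fibre_null(2)[OF fibre_null(3)] x by blast
  then show "z \<in> vscale (quillen_fibre T) (c * d) X"
    unfolding fibre_scale mem_Collect_eq using x(1)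
    by (intro exI[of _ x] exI[of _ "\<lambda>t. c * n t + m t"]) (simp add: z algebra_simps)
next
  fix z assume "z \<in> vscale (quillen_fibre T) (c * d) X"
  then obtain x n where x: "x \<in> X" "n \<in> fibre_null T" and z: "z = (\<lambda>t. c * d * x t + n t)"
    unfolding fibre_scale by blast
  have "(\<lambda>t. d * x t) \<in> vscale (quillen_fibre T) d X"
    unfolding fibre_scale mem_Collect_eq using x(1) fibre_null(1)[of T]
    by (intro exI[of _ x] exI[of _ "\<lambda>t. 0"]) simp
  then show "z \<in> vscale (quillen_fibre T) c (vscale (quillen_fibre T) d X)"
    unfolding fibre_scale[of T c] mem_Collect_eq using x(2)
    by (intro exI[of _ "\<lambda>t. d * x t"] exI[of _ n]) (simp add: z algebra_simps)
qed

lemma fibre_scale_0: "X \<noteq> {} \<Longrightarrow> vscale (quillen_fibre T) 0 X = fibre_null T"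
  unfolding fibre_scale by auto

lemma fibre_carrier_nonempty: "X \<in> vcarrier (quillen_fibre T) \<Longrightarrow> X \<noteq> {}"
  using fibre_null(1)[of T]
  unfolding quillen_fibre_def tensor_def vquot_def vcoset_def fibre_null_def by auto

text \<open>For fixed \<open>T\<close> the map depends on \<open>f\<close> only through its value at
  one operator. That suitable data exist is not established here, so nothing is claimed about
  \<open>B\<close>; \<open>X\<close> is nonempty so that scaling by 0 gives the zero vector.\<close>

lemma quillen_phi_form:
  fixes T :: "'h::chilbert \<Rightarrow>\<^sub>L 'h"
  obtains B k X where "X \<noteq> {}" "\<And>f. quillen_phi T f = vscale (quillen_fibre T) (f B * k) X"
proof -
  obtain A es L where "(SOME (A, es, L). phi_data T A es L) = (A, es, L)"
    by (metis prod_cases3)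
  moreover have "ptensor (ext_power (vdim (Ker T)) (vdual (Ker T)))
              (ext_power (vdim (Coker T)) (Coker T)) x y \<noteq> {}" for x y
    unfolding ptensor_def vcoset_def using fibre_null(1)[of T] unfolding fibre_null_def by auto
  ultimately show ?thesis
    by (intro that) (auto simp: quillen_phi_def phi_value_def)
qed

lemma openin_quillen_topology: "openin quillen_topology W \<longleftrightarrow> quillen_open W"
  unfolding quillen_topology_def by (simp add: istopology_quillen_open topology_inverse')

lemma openin_restrict_const:
  assumes "openin (top_of_set (U \<times> UNIV)) W"
  shows "openin (top_of_set U) {x \<in> U. (x, c) \<in> W}"
proof -
  have "continuous_on U (\<lambda>x. (x, c))" by (intro continuous_intros)
  then have "openin (top_of_set U) (U \<inter> (\<lambda>x. (x, c)) -` W)"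
    using assms by (intro continuous_openin_preimage[where T = "U \<times> UNIV"]) auto
  then show ?thesis by (simp add: vimage_def Int_def)
qed

section \<open>The lines \<open>quillen_D T\<close>\<close>

lemma quillen_D_ext: "f \<in> quillen_D T \<Longrightarrow> f \<in> extensional (quillen_A T)"
  unfolding quillen_D_def mem_Collect_eq by (rule conjunct1)

lemma quillen_D_eq:
  "f \<in> quillen_D T \<Longrightarrow> A \<in> quillen_A T \<Longrightarrow> B \<in> quillen_A T \<Longrightarrow>
    f B = det_F (blinfun_apply (T + A) \<circ> inv (blinfun_apply (T + B))) * f A"
  unfolding quillen_D_def mem_Collect_eq by (drule conjunct2) (drule (1) bspec)+

text \<open>One value determines all others on \<open>quillen_A T\<close>, and extensionality fixes
  the rest. This evaluates the description operator in \<open>quillen_triv\<close>.\<close>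

lemma quillen_D_unique:
  assumes "f \<in> quillen_D T" "A \<in> quillen_A T"
  shows "(THE g. g \<in> quillen_D T \<and> g A = f A) = f"
proof (rule the_equality)
  show "f \<in> quillen_D T \<and> f A = f A" using assms by simp
  fix g assume g: "g \<in> quillen_D T \<and> g A = f A"
  show "g = f"
  proof (rule extensionalityI[of _ "quillen_A T"])
    show "g \<in> extensional (quillen_A T)" "f \<in> extensional (quillen_A T)"
      using g assms(1) by (simp_all only: quillen_D_ext)
    show "g B = f B" if B: "B \<in> quillen_A T" for B
      using g quillen_D_eq[OF conjunct1[OF g] assms(2) B] quillen_D_eq[OF assms B] by simp
  qed
qed

lemma quillen_D_scale:
  assumes "f \<in> quillen_D T"
  shows "restrict (\<lambda>A. c * f A) (quillen_A T) \<in> quillen_D T"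
  unfolding quillen_D_def mem_Collect_eq
proof (intro conjI ballI)
  fix A B assume *: "A \<in> quillen_A T" "B \<in> quillen_A T"
  then show "restrict (\<lambda>A. c * f A) (quillen_A T) B =
      det_F (blinfun_apply (T + A) \<circ> inv (blinfun_apply (T + B))) *
      restrict (\<lambda>A. c * f A) (quillen_A T) A"
    using quillen_D_eq[OF assms *] by simp
qed simp

text \<open>The existence of \<open>f\<close> encodes the multiplicativity of the Fredholm determinant. Here it is
  extracted from the assumed trivialization: otherwise the local trivializations would miss
  points of the fibre over \<open>T\<close>, and these would be isolated.\<close>

lemma trivialization_generator:
  fixes \<Phi> :: "('h::chilbert \<Rightarrow>\<^sub>L 'h) \<Rightarrow> complex \<Rightarrow> 'h quillen_vec"
  assumes lin: "\<forall>T\<in>Fredholm0. vlinear cline (quillen_fibre T) (\<Phi> T)"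
    and hom: "homeomorphic_map (prod_topology (top_of_set Fredholm0) (euclidean :: complex topology))
       quillen_topology (\<lambda>(x, z). (x, \<Phi> x z))"
    and T: "T \<in> Fredholm0"
  shows "\<exists>f. f \<in> quillen_D T \<and> (\<forall>A\<in>quillen_A T. f A \<noteq> 0 \<and>
           quillen_triv A (T, 1) = (T, \<Phi> T (1 / f A)))"
proof -
  have topX: "topspace (prod_topology (top_of_set Fredholm0) (euclidean :: complex topology)) = Fredholm0 \<times> UNIV"
    by simp
  have inj: "inj_on (\<lambda>(x, z). (x, \<Phi> x z)) (Fredholm0 \<times> UNIV)"
    using homeomorphic_imp_injective_map[OF hom] topX by simp
  have inj\<Phi>: "y = z" if "\<Phi> T y = \<Phi> T z" for y z
    using inj_onD[OF inj, of "(T,y)" "(T,z)"] that T by auto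
  have car: "\<Phi> T y \<in> vcarrier (quillen_fibre T)" for y
    using lin T by (auto simp: vlinear_def cline_def)
  have \<Phi>1: "\<Phi> T y = vscale (quillen_fibre T) y (\<Phi> T 1)" for y
  proof -
    have "\<Phi> T (vscale cline y 1) = vscale (quillen_fibre T) y (\<Phi> T 1)"
      using lin T unfolding vlinear_def by (metis UNIV_I cline_def cvs.select_convs(1))
    then show ?thesis by (simp add: cline_def)
  qed
  have \<Phi>0: "\<Phi> T 0 = fibre_null T"
    using \<Phi>1[of 0] fibre_scale_0 fibre_carrier_nonempty[OF car] by metis
  have reach: "\<exists>A\<in>trace_class. T \<in> quillen_U A \<and> (\<exists>z. quillen_triv A (T, z) = (T, \<Phi> T y))" for y
  proof (rule ccontr)
    assume neg: "\<not> ?thesis"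
    have emp: "{p \<in> quillen_U A \<times> UNIV. quillen_triv A p \<in> {(T, \<Phi> T y)}} = {}" if "A \<in> trace_class" for A
      using neg that by (auto simp: quillen_triv_def)
    have "openin (top_of_set (quillen_U A \<times> UNIV))
        {p \<in> quillen_U A \<times> UNIV. quillen_triv A p \<in> {(T, \<Phi> T y)}}" if "A \<in> trace_class" for A
      unfolding emp[OF that] by (rule openin_empty)
    moreover have "{(T, \<Phi> T y)} \<subseteq> quillen_total"
      using car T by (simp add: quillen_total_def)
    ultimately have "quillen_open {(T, \<Phi> T y)}"
      unfolding quillen_open_def by blast
    then have "openin quillen_topology ((\<lambda>(x, z). (x, \<Phi> x z)) ` {(T, y)})"
      by (simp add: openin_quillen_topology)
    then have "openin (prod_topology (top_of_set Fredholm0) (euclidean :: complex topology)) {(T, y)}"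
      using homeomorphic_map_openness[OF hom, of "{(T,y)}"] T by simp
    then have "openin (prod_topology (top_of_set Fredholm0) (euclidean :: complex topology)) ({T} \<times> {y})"
      by simp
    then have "openin (euclidean :: complex topology) {y}"
      unfolding openin_prod_Times_iff by simp
    then show False using not_open_singleton[of y] by simp
  qed
  obtain X B k where X: "X \<noteq> {}" and form: "\<And>f. quillen_phi T f = vscale (quillen_fibre T) (f B * k) X"
    by (rule quillen_phi_form[of T]) (rule that)
  \<comment> \<open>Otherwise the functions entering \<open>quillen_triv\<close> would take only
    finitely many values at \<open>B\<close>, whereas by \<open>reach\<close> they produce every
    point of an injective image of the complex plane.\<close>
  have "\<exists>f\<in>quillen_D T. (\<exists>A\<in>quillen_A T. f A \<noteq> 0) \<and> B \<in> quillen_A T"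
  proof (rule ccontr)
    assume neg: "\<not> ?thesis"
    have D: "f B \<in> {0, undefined}" if f: "f \<in> quillen_D T" for f
      using neg f quillen_D_ext[OF f] unfolding extensional_def by blast
    \<comment> \<open>The three possible values: 0 if \<open>f\<close> vanishes on
      \<open>quillen_A T\<close>, \<open>undefined\<close> if \<open>B\<close> lies outside it, and
      the value of the unspecified function that the description operator returns when no
      \<open>f\<close> fits.\<close>
    define J where "J = {0, undefined, (THE f :: ('h \<Rightarrow>\<^sub>L 'h) \<Rightarrow> complex. False) B}"
    have J: "(THE f. f \<in> quillen_D T \<and> f A = z) B \<in> J" if A: "A \<in> quillen_A T" for A z
    proof (cases "\<exists>f\<in>quillen_D T. f A = z")
      case True
      then obtain f where f: "f \<in> quillen_D T" "f A = z" by blast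
      then have "(THE f. f \<in> quillen_D T \<and> f A = z) = f"
        using quillen_D_unique[OF f(1) A] by simp
      then show ?thesis using D[OF f(1)] by (auto simp: J_def)
    next
      case False
      then have "(\<lambda>f. f \<in> quillen_D T \<and> f A = z) = (\<lambda>f. False)" by auto
      then show ?thesis unfolding J_def by simp
    qed
    have "range (\<Phi> T) \<subseteq> (\<lambda>b. vscale (quillen_fibre T) (b * k) X) ` J"
    proof
      fix v assume "v \<in> range (\<Phi> T)"
      then obtain y where y: "v = \<Phi> T y" by blast
      obtain A z where A: "A \<in> trace_class" "T \<in> quillen_U A" "quillen_triv A (T, z) = (T, v)"
        using reach[of y] y by blast
      then have "v = vscale (quillen_fibre T) ((THE f. f \<in> quillen_D T \<and> f A = z) B * k) X"
        by (simp add: quillen_triv_def form)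
      moreover have "A \<in> quillen_A T" using A by (auto simp: quillen_U_def quillen_A_def)
      ultimately show "v \<in> (\<lambda>b. vscale (quillen_fibre T) (b * k) X) ` J" using J by blast
    qed
    moreover have "finite J" by (simp add: J_def)
    ultimately have "finite (range (\<Phi> T))" by (meson finite_imageI finite_subset)
    then have "finite (UNIV :: complex set)"
      using inj\<Phi> by (metis finite_imageD injI)
    then show False by (simp add: infinite_UNIV_char_0)
  qed
  then obtain g A0 where g: "g \<in> quillen_D T" "A0 \<in> quillen_A T" "g A0 \<noteq> 0" and B: "B \<in> quillen_A T"
    by blast
  have nz: "f A \<noteq> 0" if f: "f \<in> quillen_D T" and A': "A' \<in> quillen_A T" "f A' \<noteq> 0" and A: "A \<in> quillen_A T" for f A A'
  proof -
    show ?thesis using quillen_D_eq[OF f A A'(1)] A'(2) by auto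
  qed
  have ex: "\<exists>f\<in>quillen_D T. f A = z" if A: "A \<in> quillen_A T" for A z
    using quillen_D_scale[OF g(1), of "z / g A"] nz[OF g A] A
    by (intro bexI) auto
  \<comment> \<open>The generator is the element of \<open>quillen_D T\<close> that
    \<open>quillen_phi T\<close> sends to \<open>\<Phi> T 1\<close>.\<close>
  obtain A z where A: "A \<in> trace_class" "T \<in> quillen_U A" and triv: "quillen_triv A (T, z) = (T, \<Phi> T 1)"
    using reach[of 1] by blast
  have A': "A \<in> quillen_A T" using A by (auto simp: quillen_U_def quillen_A_def)
  then obtain f where f: "f \<in> quillen_D T" "f A = z" using ex by blast
  have "quillen_phi T f = \<Phi> T 1"
    using triv quillen_D_unique[OF f(1) A'] f(2) by (simp add: quillen_triv_def)
  then have f1: "vscale (quillen_fibre T) (f B * k) X = \<Phi> T 1" by (simp add: form)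
  have fB: "f B \<noteq> 0"
  proof
    assume "f B = 0"
    then have "\<Phi> T 1 = \<Phi> T 0" using f1 X by (simp add: fibre_scale_0 \<Phi>0)
    from inj\<Phi>[OF this] show False by simp
  qed
  show ?thesis
  proof (intro exI[of _ f] conjI ballI f(1))
    fix C assume C: "C \<in> quillen_A T"
    show fC: "f C \<noteq> 0" by (rule nz[OF f(1) B fB C])
    \<comment> \<open>The multiple of \<open>f\<close> with value 1 at \<open>C\<close>, which is
      what \<open>quillen_triv C\<close> selects at (T, 1).\<close>
    define h where "h = restrict (\<lambda>A. (1 / f C) * f A) (quillen_A T)"
    have h: "h \<in> quillen_D T" unfolding h_def by (rule quillen_D_scale[OF f(1)])
    have "h C = 1" using C fC by (simp add: h_def)
    then have "quillen_triv C (T, 1) = (T, quillen_phi T h)"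
      using quillen_D_unique[OF h C] by (simp add: quillen_triv_def)
    moreover have "quillen_phi T h = vscale (quillen_fibre T) (1 / f C) (\<Phi> T 1)"
      using B by (simp add: form h_def fibre_scale_scale flip: f1)
    ultimately show "quillen_triv C (T, 1) = (T, \<Phi> T (1 / f C))"
      by (simp only: \<Phi>1[of "1 / f C"])
  qed
qed

text \<open>\<open>h A T\<close> is the coordinate, in the global trivialization, of the local
  section with constant value 1 over U_A, that is, 1 / f(A) for the generator f. The gluing topology
  makes \<open>quillen_triv A\<close> continuous by definition, which is why the reciprocal is
  taken; it also turns the rule defining \<open>quillen_D\<close> into the stated transition
  law.\<close>

proposition trivialization_local_functions:
  assumes "trivial_line_bundle (top_of_set (Fredholm0 :: ('h::chilbert \<Rightarrow>\<^sub>L 'h) set))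
            quillen_fibre quillen_topology"
  obtains h :: "('h::chilbert \<Rightarrow>\<^sub>L 'h) \<Rightarrow> ('h \<Rightarrow>\<^sub>L 'h) \<Rightarrow> complex" where
    "\<And>A. A \<in> trace_class \<Longrightarrow> continuous_on (quillen_U A) (h A)"
    "\<And>A T. A \<in> trace_class \<Longrightarrow> T \<in> quillen_U A \<Longrightarrow> h A T \<noteq> 0"
    "\<And>A B T. A \<in> trace_class \<Longrightarrow> B \<in> trace_class \<Longrightarrow> T \<in> quillen_U A \<Longrightarrow> T \<in> quillen_U B \<Longrightarrow>
       h A T = det_F (blinfun_apply (T + A) \<circ> inv (blinfun_apply (T + B))) * h B T"
proof -
  obtain \<Phi> :: "('h \<Rightarrow>\<^sub>L 'h) \<Rightarrow> complex \<Rightarrow> 'h quillen_vec" where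
    lin: "\<forall>T\<in>Fredholm0. vlinear cline (quillen_fibre T) (\<Phi> T)"
    and hom: "homeomorphic_map (prod_topology (top_of_set Fredholm0) (euclidean :: complex topology))
       quillen_topology (\<lambda>(x, z). (x, \<Phi> x z))"
    using assms unfolding trivial_line_bundle_def by auto
  have inj: "inj_on (\<lambda>(x, z). (x, \<Phi> x z)) (Fredholm0 \<times> UNIV)"
    using homeomorphic_imp_injective_map[OF hom] by simp
  define f where "f T = (SOME f. f \<in> quillen_D T \<and> (\<forall>A\<in>quillen_A T. f A \<noteq> 0 \<and>
           quillen_triv A (T, 1) = (T, \<Phi> T (1 / f A))))" for T
  have f: "f T \<in> quillen_D T \<and> (\<forall>A\<in>quillen_A T. f T A \<noteq> 0 \<and>
           quillen_triv A (T, 1) = (T, \<Phi> T (1 / f T A)))" if "T \<in> Fredholm0" for T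
    unfolding f_def using trivialization_generator[OF lin hom that] by (rule someI_ex)
  have UA: "A \<in> trace_class \<Longrightarrow> T \<in> quillen_U A \<Longrightarrow> T \<in> Fredholm0 \<and> A \<in> quillen_A T" for A T
    by (auto simp: quillen_U_def quillen_A_def)
  show ?thesis
  proof (rule that[of "\<lambda>A T. 1 / f T A"])
    fix A :: "'h \<Rightarrow>\<^sub>L 'h" assume A: "A \<in> trace_class"
    show "continuous_on (quillen_U A) (\<lambda>T. 1 / f T A)"
      unfolding continuous_openin_preimage_eq
    proof (intro allI impI)
        fix S :: "complex set" assume S: "open S"
        let ?W = "(\<lambda>(x, z). (x, \<Phi> x z)) ` (Fredholm0 \<times> S)"
        have "openin (prod_topology (top_of_set Fredholm0) (euclidean :: complex topology)) (Fredholm0 \<times> S)"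
          using S by (simp add: openin_prod_Times_iff)
        then have "openin quillen_topology ?W"
          using homeomorphic_imp_open_map[OF hom] unfolding open_map_def by blast
        then have "openin (top_of_set (quillen_U A \<times> UNIV))
          {p \<in> quillen_U A \<times> UNIV. quillen_triv A p \<in> ?W}"
          using A by (auto simp: openin_quillen_topology quillen_open_def)
        then have "openin (top_of_set (quillen_U A))
          {T \<in> quillen_U A. (T, 1) \<in> {p \<in> quillen_U A \<times> UNIV. quillen_triv A p \<in> ?W}}"
          by (rule openin_restrict_const)
        also have "{T \<in> quillen_U A. (T, 1) \<in> {p \<in> quillen_U A \<times> UNIV. quillen_triv A p \<in> ?W}}
          = quillen_U A \<inter> (\<lambda>T. 1 / f T A) -` S"
        proof -
          have "quillen_triv A (T, 1) \<in> ?W \<longleftrightarrow> 1 / f T A \<in> S" if T: "T \<in> quillen_U A" for T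
          proof -
            have F: "T \<in> Fredholm0" "A \<in> quillen_A T" using UA[OF A T] by auto
            have "(T, \<Phi> T (1 / f T A)) \<in> ?W \<longleftrightarrow> (T, 1 / f T A) \<in> Fredholm0 \<times> S"
              using inj_on_image_mem_iff[OF inj, of "(T, 1 / f T A)" "Fredholm0 \<times> S"] F(1)
              by (simp add: Sigma_mono)
            then show ?thesis using f F by auto
          qed
          then show ?thesis by blast
        qed
        finally show "openin (top_of_set (quillen_U A)) (quillen_U A \<inter> (\<lambda>T. 1 / f T A) -` S)" .
    qed
  next
    fix A T :: "'h \<Rightarrow>\<^sub>L 'h" assume "A \<in> trace_class" "T \<in> quillen_U A"
    then show "1 / f T A \<noteq> 0" using UA f by auto
  next
    fix A B T :: "'h \<Rightarrow>\<^sub>L 'h" assume *: "A \<in> trace_class" "B \<in> trace_class" "T \<in> quillen_U A" "T \<in> quillen_U B"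
    then have F: "T \<in> Fredholm0" "A \<in> quillen_A T" "B \<in> quillen_A T" using UA by auto
    have "f T B = det_F (blinfun_apply (T + A) \<circ> inv (blinfun_apply (T + B))) * f T A"
      using f[OF F(1)] by (intro quillen_D_eq F(2,3)) simp
    moreover have "f T A \<noteq> 0" "f T B \<noteq> 0" using f F by auto
    ultimately show "1 / f T A = det_F (blinfun_apply (T + A) \<circ> inv (blinfun_apply (T + B))) * (1 / f T B)"
      by (simp add: field_simps)
  qed
qed

text \<open>A logarithm would make the inclusion of the circle null-homotopic in the punctured
  plane. Radial projection carries the homotopy back to the circle, which would then be
  contractible.\<close>

lemma no_continuous_logarithm_on_circle:
  assumes "continuous_on (sphere 0 1) g"
  shows "\<exists>w\<in>sphere 0 (1::real). w \<noteq> exp (g (w::complex))"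
proof (rule ccontr)
  assume "\<not> ?thesis"
  then have "\<exists>c. homotopic_with_canon (\<lambda>h. True) (sphere 0 1) (- {0}) (\<lambda>w::complex. w) (\<lambda>t. c)"
    using assms by (subst inessential_eq_continuous_logarithm) auto
  then obtain c where c: "homotopic_with_canon (\<lambda>h. True) (sphere 0 1) (- {0}) (\<lambda>w::complex. w) (\<lambda>t. c)"
    by blast
  have "homotopic_with_canon (\<lambda>h. True) (sphere 0 1) (sphere 0 1)
      ((\<lambda>z. z /\<^sub>R norm z) \<circ> (\<lambda>w::complex. w)) ((\<lambda>z. z /\<^sub>R norm z) \<circ> (\<lambda>t. c))"
    by (rule homotopic_with_compose_continuous_left[OF c]) (auto intro!: continuous_intros)
  then have "homotopic_with_canon (\<lambda>h. True) (sphere 0 1) (sphere 0 1) id (\<lambda>t. c /\<^sub>R norm c)"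
    by (rule homotopic_with_eq) auto
  then have "contractible (sphere (0::complex) 1)" unfolding contractible_def by blast
  then show False by (simp add: contractible_sphere)
qed

theorem theorem3p1:
  assumes "\<not> vfinite_dim (hspace :: 'h::chilbert cvs)"
  shows "\<not> trivial_line_bundle (top_of_set (Fredholm0 :: ('h \<Rightarrow>\<^sub>L 'h) set))
            quillen_fibre quillen_topology"
proof
  assume "trivial_line_bundle (top_of_set (Fredholm0 :: ('h \<Rightarrow>\<^sub>L 'h) set)) quillen_fibre quillen_topology"
  then obtain h :: "('h \<Rightarrow>\<^sub>L 'h) \<Rightarrow> ('h \<Rightarrow>\<^sub>L 'h) \<Rightarrow> complex" where
    cont: "\<And>A. A \<in> trace_class \<Longrightarrow> continuous_on (quillen_U A) (h A)" and
    nz: "\<And>A T. A \<in> trace_class \<Longrightarrow> T \<in> quillen_U A \<Longrightarrow> h A T \<noteq> 0" and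
    trans: "\<And>A B T. A \<in> trace_class \<Longrightarrow> B \<in> trace_class \<Longrightarrow> T \<in> quillen_U A \<Longrightarrow> T \<in> quillen_U B \<Longrightarrow>
       h A T = det_F (blinfun_apply (T + A) \<circ> inv (blinfun_apply (T + B))) * h B T"
    by (rule trivialization_local_functions) (rule that)
  obtain E :: "'h set" where E: "orthonormal E id"
    and "\<forall>x. (\<forall>e\<in>E. cinner e x = 0) \<longrightarrow> x = 0"
    by (rule exists_maximal_orthonormal)
  then have max: "\<And>x. (\<And>e. e \<in> E \<Longrightarrow> cinner e x = 0) \<Longrightarrow> x = 0" by blast
  have basis: "orthonormal_basis E" by (rule orthonormal_basis_if_maximal[OF E max])
  have "infinite E" by (rule infinite_if_maximal_orthonormal[OF E max assms])
  then obtain e :: "nat \<Rightarrow> 'h" where e: "inj e" "range e \<subseteq> E"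
    using infinite_countable_subset by blast
  have orth: "orthonormal UNIV e"
    using E e(2) unfolding orthonormal_def by (auto simp: inj_eq[OF e(1)] image_subset_iff)
  define u where "u = e 0"
  have uE: "u \<in> E" using e by (auto simp: u_def)
  have u: "cinner u u = 1" using orth by (simp add: u_def orthonormal_def)
  \<comment> \<open>Adding \<open>A\<close> shifts the parameter of the dilation by 2, which keeps
    it away from 0 on the whole closed unit disc, the singular centre included.\<close>
  define A where "A = cmul 2 (rank1 u)"
  have A: "A \<in> trace_class" using rank1_trace_class[OF basis uE, of 2] by (simp add: A_def)
  have "cmul 0 (rank1 u) = 0" by (rule blinfun_eqI) simp
  then have Z: "(0 :: 'h \<Rightarrow>\<^sub>L 'h) \<in> trace_class" using rank1_trace_class[OF basis uE, of 0] by simp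
  have TA: "dilation u w + A = dilation u (w + 2)" for w
  proof (rule blinfun_eqI)
    fix x
    have "(dilation u w + A) x = x + ((w - 1) * cinner u x + 2 * cinner u x) *\<^sub>C u"
      by (simp add: dilation_apply A_def blinfun.add_left scaleC_scaleC scaleC_add_left)
    also have "(w - 1) * cinner u x + 2 * cinner u x = ((w + 2) - 1) * cinner u x"
      by (simp add: algebra_simps)
    finally show "(dilation u w + A) x = dilation u (w + 2) x" by (simp only: dilation_apply)
  qed
  have w2: "w + 2 \<noteq> 0" if "w \<in> cball 0 1" for w :: complex
  proof
    assume "w + 2 = 0"
    then have "w = - 2" by (simp add: eq_neg_iff_add_eq_0)
    then show False using that by simp
  qed
  have UA: "dilation u w \<in> quillen_U A" if "w \<in> cball 0 1" for w
  proof -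
    have "op_invertible (dilation u w + A)"
      using w2[OF that] dilation_in_quillen_U_0[OF u] unfolding TA by (simp add: quillen_U_def)
    then show ?thesis by (simp add: quillen_U_def dilation_Fredholm0 u)
  qed
  have cd: "continuous_on S (dilation u)" for S
    unfolding dilation_def by (intro continuous_intros)

  obtain G where G: "continuous_on ({0..1} \<times> sphere 0 1) G" "G ` ({0..1} \<times> sphere 0 1) \<subseteq> quillen_U 0"
    and G0: "\<And>w. G (0::real, w) = id_blinfun" and G1: "\<And>w. w \<in> sphere 0 1 \<Longrightarrow> G (1, w) = dilation u w"
    using dilation_loop_null_homotopic[OF orth] unfolding u_def by metis
  \<comment> \<open>Composition with \<open>h 0\<close> carries the contraction from GL(H) to the
    punctured plane, and a null-homotopic map into that plane has a continuous logarithm.\<close>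
  have "homotopic_with_canon (\<lambda>h. True) (sphere 0 1) (- {0}) (\<lambda>w. h 0 id_blinfun) (\<lambda>w. h 0 (G (1, w)))"
    unfolding homotopic_with_def
  proof (intro exI[of _ "\<lambda>p. h 0 (G p)"] conjI)
    show "continuous_map (prod_topology (top_of_set {0..1}) (top_of_set (sphere 0 1))) (top_of_set (- {0})) (\<lambda>p. h 0 (G p))"
      using continuous_on_compose2[OF cont[OF Z] G] nz[OF Z] G(2)
      by (auto simp: continuous_map_in_subtopology image_subset_iff)
  qed (auto simp: G0)
  then have "\<exists>c. homotopic_with_canon (\<lambda>h. True) (sphere 0 1) (- {0}) (\<lambda>w. h 0 (G (1, w))) (\<lambda>w. c)"
    using homotopic_with_symD by blast
  then obtain g where g: "continuous_on (sphere 0 1) g" "\<And>w. w \<in> sphere 0 1 \<Longrightarrow> h 0 (dilation u w) = exp (g w)"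
    unfolding inessential_eq_continuous_logarithm using G1 by metis

  \<comment> \<open>The numerator is chosen so that on the circle the product with
    \<open>h 0\<close> is exactly \<open>w\<close>. Both numerator and denominator are free of zeros
    on the disc, so the quotient has a logarithm there.\<close>
  have "continuous_on (cball 0 1) (\<lambda>w. (w + 2) / h A (dilation u w))"
    using nz[OF A UA] by (intro continuous_intros continuous_on_compose2[OF cont[OF A] cd]) (auto simp: UA)
  moreover have "(w + 2) / h A (dilation u w) \<noteq> 0" if "w \<in> cball 0 1" for w
    using w2[OF that] nz[OF A UA[OF that]] by simp
  ultimately obtain k where k: "continuous_on (cball 0 1) k"
    "\<And>w. w \<in> cball 0 1 \<Longrightarrow> (w + 2) / h A (dilation u w) = exp (k w)"
    by (rule continuous_logarithm_on_cball) (assumption | rule that)+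

  have "w = exp (g w + k w)" if w: "w \<in> sphere 0 1" for w
  proof -
    have w0: "w \<noteq> 0" and wb: "w \<in> cball 0 1" using w by auto
    have "inv (dilation u w) = dilation u (1 / w)"
      using dilation_compose[OF u, of w "1 / w"] dilation_compose[OF u, of "1 / w" w] w0
      by (intro inv_equality) (simp_all add: dilation_1 flip: blinfun_apply_blinfun_compose)
    then have "blinfun_apply (dilation u w + A) \<circ> inv (blinfun_apply (dilation u w + 0))
        = dilation u ((w + 2) * (1 / w))"
      by (simp add: TA fun_eq_iff dilation_compose[OF u] flip: blinfun_apply_blinfun_compose)
    also have "\<dots> = (\<lambda>x. x + (2 / w * cinner u x) *\<^sub>C u)"
    proof
      fix x
      have "(w + 2) * (1 / w) - 1 = 2 / w" using w0 by (simp add: field_simps)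
      then show "dilation u ((w + 2) * (1 / w)) x = x + (2 / w * cinner u x) *\<^sub>C u"
        by (simp only: dilation_apply)
    qed
    finally have "det_F (blinfun_apply (dilation u w + A) \<circ> inv (blinfun_apply (dilation u w + 0))) = 1 + 2 / w"
      using det_F_rank1[OF u, of "2 / w"] w0 by simp
    then have "h A (dilation u w) = (1 + 2 / w) * h 0 (dilation u w)"
      using trans[OF A Z UA[OF wb] dilation_in_quillen_U_0[OF u w0]] by simp
    then have "w * h A (dilation u w) = (w + 2) * h 0 (dilation u w)"
      using w0 by (simp add: field_simps)
    then have "w = h 0 (dilation u w) * ((w + 2) / h A (dilation u w))"
      using nz[OF A UA[OF wb]] by (simp add: field_simps)
    then show ?thesis using g(2)[OF w] k(2)[OF wb] by (simp add: exp_add)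
  qed
  moreover have "continuous_on (sphere 0 1) (\<lambda>w. g w + k w)"
    by (intro continuous_intros g continuous_on_subset[OF k(1)]) auto
  ultimately show False using no_continuous_logarithm_on_circle by blast
qed

end
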